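(* Let $\mathcal{E}_A$ be a trace-preserving super-operator with rational entries on a $d$-dimensional Hilbert space $\mathcal{H}_A$, let $\mathcal{H}_B$ be a Hilbert space (of arbitrary dimension), let $\rho_{AB}$ be a state on $\mathcal{H}_A\otimes\mathcal{H}_B$, and let $p$ be a projection on $\mathcal{H}_A\otimes\mathcal{H}_B$. Then $$\big((\mathcal{E}_A^k\otimes\mathcal{I}_B)(\rho_{AB})\models p\ \text{ for all }k\ge0\big)\iff \sum_{k=0}^{t-1}\frac{(\mathcal{E}_A^k\otimes\mathcal{I}_B)(\rho_{AB})}{t}\models p,$$ where $t$ can be chosen to be $d^2-1$ (independently of the dimension of $\mathcal{H}_B$).
   Context: $\mathcal{I}_B$ is the identity super-operator on $\mathcal{H}_B$. For a positive operator $\sigma$ and a projection $p$, $\sigma\models p$ means $\mathrm{supp}(\sigma)\subseteq p$, where $\mathrm{supp}$ is the closure of the span of eigenvectors with nonzero eigenvalue.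
   Formalization: The formal theorem assumes d ≥ 2; for d = 1 the choice t = d²−1 equals 0, so the average on the right-hand side divides by zero and the statement is undefined. *)

theory Defs
  imports "HOL-Analysis.Analysis" "HOL-Library.Nonpos_Ints"
begin

subsection \<open>Complex Hilbert spaces\<close>

text \<open>The inner product is conjugate-linear in its first argument.\<close>

class chilbert_space = banach +
  fixes scaleC :: "complex \<Rightarrow> 'a \<Rightarrow> 'a"  (infixr \<open>*\<^sub>C\<close> 75)
    and cinner :: "'a \<Rightarrow> 'a \<Rightarrow> complex"
  assumes scaleC_add_right: "c *\<^sub>C (x + y) = c *\<^sub>C x + c *\<^sub>C y"
    and scaleC_add_left: "(b + c) *\<^sub>C x = b *\<^sub>C x + c *\<^sub>C x"
    and scaleC_scaleC: "b *\<^sub>C (c *\<^sub>C x) = (b * c) *\<^sub>C x"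
    and scaleC_of_real: "complex_of_real r *\<^sub>C x = r *\<^sub>R x"
    and cinner_commute: "cinner x y = cnj (cinner y x)"
    and cinner_add_right: "cinner x (y + z) = cinner x y + cinner x z"
    and cinner_scaleC_right: "cinner x (c *\<^sub>C y) = c * cinner x y"
    and cinner_self: "cinner x x = complex_of_real ((norm x)\<^sup>2)"

instantiation complex :: chilbert_space
begin

definition scaleC_complex :: "complex \<Rightarrow> complex \<Rightarrow> complex"
  where "scaleC_complex c z = c * z"

definition cinner_complex :: "complex \<Rightarrow> complex \<Rightarrow> complex"
  where "cinner_complex z w = cnj z * w"

instance
  by standard
    (auto simp: scaleC_complex_def cinner_complex_def algebra_simps scaleR_conv_of_real
      complex_norm_square simp del: of_real_power)

end

text \<open>
  The Hilbert space direct sum of finitely many copies of a Hilbert space; for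
  \<^typ>\<open>complex\<close> this is the standard space of complex column vectors.
\<close>

instantiation vec :: (chilbert_space, finite) chilbert_space
begin

definition scaleC_vec :: "complex \<Rightarrow> 'a ^ 'b \<Rightarrow> 'a ^ 'b"
  where "scaleC_vec c x = (\<chi> i. c *\<^sub>C (x $ i))"

definition cinner_vec :: "'a ^ 'b \<Rightarrow> 'a ^ 'b \<Rightarrow> complex"
  where "cinner_vec x y = (\<Sum>i\<in>UNIV. cinner (x $ i) (y $ i))"

instance
proof
  fix x y z :: "'a ^ 'b" and b c :: complex and r :: real
  show "c *\<^sub>C (x + y) = c *\<^sub>C x + c *\<^sub>C y" "(b + c) *\<^sub>C x = b *\<^sub>C x + c *\<^sub>C x"
    "b *\<^sub>C (c *\<^sub>C x) = (b * c) *\<^sub>C x" "complex_of_real r *\<^sub>C x = r *\<^sub>R x"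
    by (simp_all add: scaleC_vec_def vec_eq_iff scaleC_add_right scaleC_add_left
        scaleC_scaleC scaleC_of_real)
  show "cinner x y = cnj (cinner y x)"
    unfolding cinner_vec_def cnj_sum by (rule sum.cong[OF refl]) (rule cinner_commute)
  show "cinner x (y + z) = cinner x y + cinner x z" "cinner x (c *\<^sub>C y) = c * cinner x y"
    by (simp_all add: cinner_vec_def scaleC_vec_def cinner_add_right cinner_scaleC_right
        sum.distrib sum_distrib_left)
  show "cinner x x = complex_of_real ((norm x)\<^sup>2)"
    by (simp add: cinner_vec_def cinner_self norm_vec_def L2_set_def sum_nonneg)
qed

end

global_interpretation chilbert: vector_space "scaleC :: complex \<Rightarrow> 'a \<Rightarrow> 'a::chilbert_space"
  defines cspan = chilbert.span
  by standard
    (auto simp: scaleC_add_right scaleC_add_left scaleC_scaleC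
      scaleC_of_real[of 1, simplified])

definition orthonormal_basis :: "'a::chilbert_space set \<Rightarrow> bool"
  where "orthonormal_basis B \<longleftrightarrow>
    (\<forall>x\<in>B. \<forall>y\<in>B. cinner x y = (if x = y then 1 else 0)) \<and> closure (cspan B) = UNIV"


subsection \<open>Operators, states and projections\<close>

abbreviation clinear :: "('a::chilbert_space \<Rightarrow> 'b::chilbert_space) \<Rightarrow> bool"
  where "clinear \<equiv> Vector_Spaces.linear scaleC scaleC"

definition bounded_clinear :: "('a::chilbert_space \<Rightarrow> 'b::chilbert_space) \<Rightarrow> bool"
  where "bounded_clinear T \<longleftrightarrow> clinear T \<and> bounded_linear T"

definition positive_operator :: "('a::chilbert_space \<Rightarrow> 'a) \<Rightarrow> bool"
  where "positive_operator T \<longleftrightarrow> bounded_clinear T \<and> (\<forall>x. cinner x (T x) \<in> \<real>\<^sub>\<ge>\<^sub>0)"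

text \<open>
  A positive operator is trace class with trace one iff its diagonal sums to one in some
  orthonormal basis; by positivity this does not depend on the basis.
\<close>

definition density_operator :: "('a::chilbert_space \<Rightarrow> 'a) \<Rightarrow> bool"
  where "density_operator \<rho> \<longleftrightarrow> positive_operator \<rho> \<and>
    (\<exists>B. orthonormal_basis B \<and> ((\<lambda>b. cinner b (\<rho> b)) has_sum 1) B)"

definition is_projection :: "('a::chilbert_space \<Rightarrow> 'a) \<Rightarrow> bool"
  where "is_projection P \<longleftrightarrow> bounded_clinear P \<and> (\<forall>x. P (P x) = P x) \<and>
    (\<forall>x y. cinner (P x) y = cinner x (P y))"

definition supp :: "('a::chilbert_space \<Rightarrow> 'a) \<Rightarrow> 'a set"
  where "supp T = closure (cspan {v. v \<noteq> 0 \<and> (\<exists>c. c \<noteq> 0 \<and> T v = c *\<^sub>C v)})"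

text \<open>A projection is identified with the closed subspace that is its range.\<close>

definition satisfies :: "('a::chilbert_space \<Rightarrow> 'a) \<Rightarrow> ('a \<Rightarrow> 'a) \<Rightarrow> bool"  (infix \<open>\<Turnstile>\<close> 50)
  where "\<sigma> \<Turnstile> P \<longleftrightarrow> supp \<sigma> \<subseteq> range P"


subsection \<open>Super-operators on a finite-dimensional space\<close>

definition matrix_unit :: "'d \<Rightarrow> 'd \<Rightarrow> complex ^ 'd ^ 'd"
  where "matrix_unit i j = (\<chi> k l. if k = i \<and> l = j then 1 else 0)"

text \<open>
  \<open>X i j\<close> for \<open>i, j < n\<close> are the blocks of an operator on the tensor product of an
  \<open>n\<close>-dimensional ancilla with the given space.
\<close>

definition positive_block_matrix :: "nat \<Rightarrow> (nat \<Rightarrow> nat \<Rightarrow> complex ^ 'd ^ 'd) \<Rightarrow> bool"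
  where "positive_block_matrix n X \<longleftrightarrow>
    (\<forall>v. (\<Sum>i<n. \<Sum>j<n. cinner (v i) (X i j *v v j)) \<in> \<real>\<^sub>\<ge>\<^sub>0)"

definition completely_positive :: "(complex ^ 'd ^ 'd \<Rightarrow> complex ^ 'd ^ 'd) \<Rightarrow> bool"
  where "completely_positive E \<longleftrightarrow>
    (\<forall>n X. positive_block_matrix n X \<longrightarrow> positive_block_matrix n (\<lambda>i j. E (X i j)))"

definition super_operator :: "(complex ^ 'd ^ 'd \<Rightarrow> complex ^ 'd ^ 'd) \<Rightarrow> bool"
  where "super_operator E \<longleftrightarrow> clinear E \<and> completely_positive E"

definition trace_preserving :: "(complex ^ 'd ^ 'd \<Rightarrow> complex ^ 'd ^ 'd) \<Rightarrow> bool"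
  where "trace_preserving E \<longleftrightarrow> (\<forall>X. trace (E X) = trace X)"

text \<open>
  The entries of a super-operator are those of its matrix with respect to the matrix units;
  a complex number counts as rational if its real and imaginary parts are.
\<close>

definition rational_entries :: "(complex ^ 'd ^ 'd \<Rightarrow> complex ^ 'd ^ 'd) \<Rightarrow> bool"
  where "rational_entries E \<longleftrightarrow>
    (\<forall>i j k l. Re (E (matrix_unit i j) $ k $ l) \<in> \<rat> \<and> Im (E (matrix_unit i j) $ k $ l) \<in> \<rat>)"


subsection \<open>Tensor products with a finite-dimensional first factor\<close>

text \<open>
  The Hilbert space tensor product of \<^typ>\<open>complex ^ 'd\<close> and \<open>'b\<close> is \<open>'b ^ 'd\<close>: a
  vector \<open>x\<close> stands for the sum of the \<open>e\<^sub>i \<otimes> x $ i\<close> over the standard basis.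
\<close>

definition tensor_vec :: "complex ^ 'd \<Rightarrow> 'b::chilbert_space \<Rightarrow> 'b ^ 'd"
  where "tensor_vec a b = (\<chi> i. (a $ i) *\<^sub>C b)"

definition tensor_op ::
    "complex ^ 'd ^ 'd \<Rightarrow> ('b::chilbert_space \<Rightarrow> 'b) \<Rightarrow> 'b ^ 'd \<Rightarrow> 'b ^ 'd"
  where "tensor_op A S x = (\<chi> k. \<Sum>l\<in>UNIV. (A $ k $ l) *\<^sub>C S (x $ l))"

definition block :: "('b::chilbert_space ^ 'd \<Rightarrow> 'b ^ 'd) \<Rightarrow> 'd \<Rightarrow> 'd \<Rightarrow> 'b \<Rightarrow> 'b"
  where "block T i j b = T (axis j b) $ i"

text \<open>
  Every linear operator \<open>T\<close> is the sum of the \<open>matrix_unit i j \<otimes> block T i j\<close>, so this is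
  the only linear map that sends each \<open>A \<otimes> S\<close> to \<open>E A \<otimes> S\<close>.
\<close>

definition tensor_id ::
    "(complex ^ 'd ^ 'd \<Rightarrow> complex ^ 'd ^ 'd) \<Rightarrow>
     ('b::chilbert_space ^ 'd \<Rightarrow> 'b ^ 'd) \<Rightarrow> 'b ^ 'd \<Rightarrow> 'b ^ 'd"
  where "tensor_id E T x =
    (\<Sum>i\<in>UNIV. \<Sum>j\<in>UNIV. tensor_op (E (matrix_unit i j)) (block T i j) x)"

lemma clinear_add: "clinear f \<Longrightarrow> f (x + y) = f x + f y"
  and clinear_scaleC: "clinear f \<Longrightarrow> f (c *\<^sub>C x) = c *\<^sub>C f x"
  and clinear_zero: "clinear f \<Longrightarrow> f 0 = 0"
  and clinear_sum: "clinear f \<Longrightarrow> f (sum g I) = (\<Sum>i\<in>I. f (g i))"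
proof -
  assume "clinear f"
  then interpret Vector_Spaces.linear scaleC scaleC f .
  show "f (x + y) = f x + f y" "f (c *\<^sub>C x) = c *\<^sub>C f x" "f 0 = 0"
    "f (sum g I) = (\<Sum>i\<in>I. f (g i))"
    by (simp_all add: add scale zero sum)
qed

lemma cinner_scaleC_left: "cinner (c *\<^sub>C x) y = cnj c * cinner x y"
  by (metis cinner_commute cinner_scaleC_right complex_cnj_mult)

lemma cinner_tensor_vec: "cinner (tensor_vec a b) (tensor_vec a' b') = cinner a a' * cinner b b'"
  by (simp add: cinner_vec_def tensor_vec_def cinner_complex_def cinner_scaleC_left
      cinner_scaleC_right sum_distrib_left mult_ac)

lemma sum_tensor_vec: "(\<Sum>i\<in>UNIV. tensor_vec (axis i 1) (x $ i)) = x"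
proof -
  have "(\<Sum>i\<in>UNIV. tensor_vec (axis i 1) (x $ i)) $ k = x $ k" for k
  proof -
    have "(\<Sum>i\<in>UNIV. tensor_vec (axis i 1) (x $ i)) $ k = (\<Sum>i\<in>UNIV. if i = k then x $ i else 0)"
      unfolding sum_component by (rule sum.cong) (auto simp: tensor_vec_def axis_def)
    then show ?thesis by simp
  qed
  then show ?thesis by (simp add: vec_eq_iff)
qed

lemma tensor_op_tensor_vec:
  assumes "clinear S"
  shows "tensor_op A S (tensor_vec a b) = tensor_vec (A *v a) (S b)"
  by (simp add: tensor_op_def tensor_vec_def vec_eq_iff matrix_vector_mult_def
      clinear_scaleC[OF assms] scaleC_scaleC chilbert.scale_sum_left)

lemma sum_matrix_unit: "(\<Sum>i\<in>UNIV. \<Sum>j\<in>UNIV. (A $ i $ j) *\<^sub>C matrix_unit i j) = A"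
proof -
  have "(\<Sum>i\<in>UNIV. \<Sum>j\<in>UNIV. (A $ i $ j) *\<^sub>C matrix_unit i j) $ k $ l = A $ k $ l" for k l
  proof -
    have "(\<Sum>i\<in>UNIV. \<Sum>j\<in>UNIV. (A $ i $ j) *\<^sub>C matrix_unit i j) $ k $ l =
        (\<Sum>i\<in>UNIV. \<Sum>j\<in>UNIV. if j = l then if i = k then A $ i $ j else 0 else 0)"
      unfolding sum_component
      by (intro sum.cong) (auto simp: matrix_unit_def scaleC_vec_def scaleC_complex_def)
    then show ?thesis by simp
  qed
  then show ?thesis by (simp add: vec_eq_iff)
qed

lemma tensor_id_tensor_op:
  assumes "clinear E" and "clinear S"
  shows "tensor_id E (tensor_op A S) = tensor_op (E A) S"
proof
  fix x
  have blk: "block (tensor_op A S) i j b = (A $ i $ j) *\<^sub>C S b" for i j b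
  proof -
    have "block (tensor_op A S) i j b = (\<Sum>l\<in>UNIV. if l = j then (A $ i $ l) *\<^sub>C S b else 0)"
      unfolding block_def tensor_op_def vec_lambda_beta
      by (rule sum.cong) (auto simp: axis_def clinear_zero[OF assms(2)])
    then show ?thesis by simp
  qed
  have EA: "E A = (\<Sum>i\<in>UNIV. \<Sum>j\<in>UNIV. (A $ i $ j) *\<^sub>C E (matrix_unit i j))"
    by (subst sum_matrix_unit[of A, symmetric])
      (simp only: clinear_sum[OF assms(1)] clinear_scaleC[OF assms(1)])
  have "tensor_id E (tensor_op A S) x $ k = tensor_op (E A) S x $ k" for k
  proof -
    have "tensor_op (E A) S x $ k =
        (\<Sum>l\<in>UNIV. \<Sum>i\<in>UNIV. \<Sum>j\<in>UNIV. (A $ i $ j * E (matrix_unit i j) $ k $ l) *\<^sub>C S (x $ l))"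
      by (simp add: tensor_op_def EA scaleC_vec_def scaleC_complex_def chilbert.scale_sum_left)
    also have "\<dots> =
        (\<Sum>i\<in>UNIV. \<Sum>j\<in>UNIV. \<Sum>l\<in>UNIV. (A $ i $ j * E (matrix_unit i j) $ k $ l) *\<^sub>C S (x $ l))"
      by (subst sum.swap, rule sum.cong[OF refl], subst sum.swap) simp
    also have "\<dots> = tensor_id E (tensor_op A S) x $ k"
      by (simp add: tensor_id_def tensor_op_def blk scaleC_scaleC mult.commute)
    finally show ?thesis by simp
  qed
  then show "tensor_id E (tensor_op A S) x = tensor_op (E A) S x" by (simp add: vec_eq_iff)
qed

lemma sum_tensor_op_block:
  assumes "clinear T"
  shows "(\<Sum>i\<in>UNIV. \<Sum>j\<in>UNIV. tensor_op (matrix_unit i j) (block T i j) x) = T x"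
proof -
  have x: "x = (\<Sum>j\<in>UNIV. axis j (x $ j))"
    by (subst vec_eq_iff) (simp add: axis_def)
  have "(\<Sum>i\<in>UNIV. \<Sum>j\<in>UNIV. tensor_op (matrix_unit i j) (block T i j) x) $ k = T x $ k" for k
  proof -
    have "tensor_op (matrix_unit i j) (block T i j) x $ k
        = (if i = k then T (axis j (x $ j)) $ i else 0)" for i j
    proof -
      have "tensor_op (matrix_unit i j) (block T i j) x $ k
          = (\<Sum>l\<in>UNIV. if l = j then if i = k then T (axis j (x $ l)) $ i else 0 else 0)"
        unfolding tensor_op_def vec_lambda_beta
        by (rule sum.cong) (auto simp: matrix_unit_def block_def)
      then show ?thesis by simp
    qed
    then have "(\<Sum>i\<in>UNIV. \<Sum>j\<in>UNIV. tensor_op (matrix_unit i j) (block T i j) x) $ k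
        = (\<Sum>j\<in>UNIV. \<Sum>i\<in>UNIV. if i = k then T (axis j (x $ j)) $ i else 0)"
      by (simp only: sum_component) (rule sum.swap)
    also have "\<dots> = (\<Sum>j\<in>UNIV. T (axis j (x $ j))) $ k" by simp
    also have "(\<Sum>j\<in>UNIV. T (axis j (x $ j))) = T x"
      by (subst (2) x) (simp only: clinear_sum[OF assms])
    finally show ?thesis .
  qed
  then show ?thesis by (simp add: vec_eq_iff)
qed

end

theory Submission
  imports Defs
begin

text \<open>
  Write \<open>E X = \<Sum>\<^sub>m K\<^sub>m X K\<^sub>m\<^sup>*\<close> in Kraus form and put \<open>L\<^sub>m = K\<^sub>m\<^sup>*\<close>. A positive compact operator is
  supported in a closed subspace iff its quadratic form vanishes on the orthogonal complement
  (spectral theorem), and the form of \<open>(E\<^sup>k \<otimes> I) \<rho>\<close> vanishes at \<open>x\<close> iff \<open>\<rho> (A \<otimes> 1) x = 0\<close> for every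
  product \<open>A\<close> of \<open>k\<close> of the \<open>L\<^sub>m\<close>. For fixed \<open>x\<close> this is a linear condition on \<open>A\<close>, so it suffices
  that the products of fewer than \<open>d\<^sup>2 - 1\<close> factors span all products. The spans \<open>U n\<close> of the products
  of fewer than \<open>n\<close> factors increase strictly until they are stationary. If they were not
  stationary at \<open>n = d\<^sup>2 - 1\<close>, then counting dimensions gives \<open>dim (U 2) = 2\<close> and that \<open>U (d\<^sup>2)\<close> is
  the full matrix algebra; but the first makes the \<open>L\<^sub>m\<close> commute, and the full matrix algebra is not
  commutative for \<open>d \<ge> 2\<close>.
\<close>


subsection \<open>Positive operators\<close>

lemma cinner_add_left: "cinner (x + y) z = cinner x z + cinner y z"
  by (metis cinner_add_right cinner_commute complex_cnj_add)

lemma cinner_zero_right [simp]: "cinner x 0 = 0"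
  using cinner_add_right[of x 0 0] by simp

lemma cinner_zero_left [simp]: "cinner 0 x = 0"
  using cinner_add_left[of 0 0 x] by simp

lemma cinner_minus_right: "cinner x (- y) = - cinner x y"
  using cinner_add_right[of x y "- y"] by (simp add: eq_neg_iff_add_eq_0 add.commute)

lemma cinner_minus_left: "cinner (- x) y = - cinner x y"
  using cinner_add_left[of x "- x" y] by (simp add: eq_neg_iff_add_eq_0 add.commute)

lemma cinner_diff_right: "cinner x (y - z) = cinner x y - cinner x z"
  by (metis cinner_add_right cinner_minus_right diff_conv_add_uminus)

lemma cinner_diff_left: "cinner (x - y) z = cinner x z - cinner y z"
  by (metis cinner_add_left cinner_minus_left diff_conv_add_uminus)

lemma cinner_sum_right: "cinner x (sum f I) = (\<Sum>i\<in>I. cinner x (f i))"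
  by (induction I rule: infinite_finite_induct) (simp_all add: cinner_add_right)

lemma cinner_sum_left: "cinner (sum f I) x = (\<Sum>i\<in>I. cinner (f i) x)"
  by (induction I rule: infinite_finite_induct) (simp_all add: cinner_add_left)

lemma cinner_eq_zero_iff [simp]: "cinner x x = 0 \<longleftrightarrow> x = 0"
  by (simp add: cinner_self)

lemma norm_scaleC: "norm (c *\<^sub>C x) = cmod c * norm (x::'a::chilbert_space)"
proof -
  have "complex_of_real ((norm (c *\<^sub>C x))\<^sup>2) = (cnj c * c) * cinner x x"
    by (simp only: cinner_self[symmetric] cinner_scaleC_left cinner_scaleC_right mult_ac)
  also have "\<dots> = complex_of_real ((cmod c * norm x)\<^sup>2)"
    by (simp add: cinner_self power_mult_distrib complex_norm_square mult_ac del: of_real_power)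
  finally have "(norm (c *\<^sub>C x))\<^sup>2 = (cmod c * norm x)\<^sup>2"
    using of_real_eq_iff by blast
  then show ?thesis by (simp add: power2_eq_iff_nonneg)
qed

text \<open>Polarization: reality of the form at \<open>x + y\<close> links the imaginary parts of
  \<open>cinner x (T y)\<close> and \<open>cinner y (T x)\<close>, reality at
  \<open>x + \<i> *\<^sub>C y\<close> their real parts.\<close>

lemma positive_operator_selfadjoint:
  assumes "positive_operator T"
  shows "cinner (T x) y = cinner x (T y)"
proof -
  have T: "clinear T" and pos: "Im (cinner z (T z)) = 0" for z
    using assms by (auto simp: positive_operator_def bounded_clinear_def complex_nonneg_Reals_iff)
  have "Im (cinner x (T y)) + Im (cinner y (T x)) = 0"
    using pos[of "x + y"] pos[of x] pos[of y]
    by (simp add: clinear_add[OF T] cinner_add_left cinner_add_right)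
  moreover have "Re (cinner x (T y)) = Re (cinner y (T x))"
    using pos[of "x + \<i> *\<^sub>C y"] pos[of x] pos[of y]
    by (simp add: clinear_add[OF T] clinear_scaleC[OF T] cinner_add_left cinner_add_right
        cinner_scaleC_left cinner_scaleC_right)
  ultimately have "cinner x (T y) = cnj (cinner y (T x))"
    by (simp add: complex_eq_iff)
  then show ?thesis by (metis cinner_commute)
qed

text \<open>\<open>cinner x (T y)\<close> is a possibly degenerate inner product, so the classical
  discriminant argument applies, with the degenerate case \<open>b = 0\<close> treated
  apart.\<close>

lemma positive_operator_Cauchy_Schwarz:
  assumes "positive_operator T"
  shows "(cmod (cinner x (T y)))\<^sup>2 \<le> Re (cinner x (T x)) * Re (cinner y (T y))"
proof -
  have T: "clinear T" and pos: "Re (cinner z (T z)) \<ge> 0" for z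
    using assms by (auto simp: positive_operator_def bounded_clinear_def complex_nonneg_Reals_iff)
  define a b c where "a = Re (cinner x (T x))" and "b = Re (cinner y (T y))"
    and "c = cinner x (T y)"
  have c': "cinner y (T x) = cnj c"
    unfolding c_def by (metis positive_operator_selfadjoint[OF assms] cinner_commute)
  have ineq: "0 \<le> a - 2 * s * (cmod c)\<^sup>2 + s\<^sup>2 * (cmod c)\<^sup>2 * b" for s :: real
  proof -
    \<comment> \<open>The phase of \<open>cnj c\<close> makes both cross terms real, which leaves a
      real quadratic in \<open>s\<close>.\<close>
    define z where "z = - complex_of_real s * cnj c"
    have "Re (cinner (x + z *\<^sub>C y) (T (x + z *\<^sub>C y))) =
        a + Re (z * c) + Re (cnj z * cnj c) + Re (cnj z * z * cinner y (T y))"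
      by (simp add: clinear_add[OF T] clinear_scaleC[OF T] cinner_add_left cinner_add_right
        cinner_scaleC_left cinner_scaleC_right a_def c_def[symmetric] c' algebra_simps)
    also have "z * c = complex_of_real (- s * (cmod c)\<^sup>2)"
      by (simp add: z_def complex_norm_square del: of_real_power)
    also have "cnj z * cnj c = complex_of_real (- s * (cmod c)\<^sup>2)"
      by (simp add: z_def complex_norm_square mult_ac del: of_real_power)
    also have "cnj z * z = complex_of_real (s\<^sup>2 * (cmod c)\<^sup>2)"
      by (simp add: z_def complex_norm_square power2_eq_square[of s] mult_ac del: of_real_power)
    finally show ?thesis
      using pos[of "x + z *\<^sub>C y"] by (simp add: b_def del: of_real_power of_real_mult)
  qed
  have b: "b \<ge> 0" using pos b_def by simp
  have "(cmod c)\<^sup>2 \<le> a * b"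
  proof (cases "b = 0")
    case True
    have "(cmod c)\<^sup>2 = 0"
    proof (rule ccontr)
      assume n: "(cmod c)\<^sup>2 \<noteq> 0"
      \<comment> \<open>For \<open>b = 0\<close> the bound is affine in \<open>s\<close>; this
        \<open>s\<close> gives it the value -1.\<close>
      then show False using ineq[of "(a + 1) / (2 * (cmod c)\<^sup>2)"] True by simp
    qed
    then show ?thesis using True by simp
  next
    case False
    \<comment> \<open>\<open>s = 1 / b\<close> is the minimizer of the quadratic up to scaling:
      there it equals \<open>a - (cmod c)\<^sup>2 / b\<close>.\<close>
    then have "0 \<le> a - (cmod c)\<^sup>2 / b"
      using ineq[of "1 / b"] by (simp add: field_simps power2_eq_square)
    then show ?thesis using b False by (simp add: field_simps)
  qed
  then show ?thesis by (simp add: a_def b_def c_def)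
qed

section \<open>Linear maps, norm bounds and continuity\<close>

lemma clinearI:
  assumes "\<And>x y. f (x + y) = f x + f y" and "\<And>c x. f (c *\<^sub>C x) = c *\<^sub>C f x"
  shows "clinear f"
  using assms by (simp add: Vector_Spaces.linear_iff chilbert.vector_space_axioms)

lemma clinear_diff: "clinear f \<Longrightarrow> f (x - y) = f x - f y"
  by (metis add_diff_cancel_right' clinear_add diff_add_cancel)

lemma bounded_clinear_ident: "bounded_clinear (\<lambda>x. x)"
  by (simp add: bounded_clinear_def clinearI)

lemma cinner_Cauchy_Schwarz: "cmod (cinner x y) \<le> norm x * norm y"
proof -
  have "positive_operator (\<lambda>x::'a. x)"
    by (simp add: positive_operator_def bounded_clinear_ident cinner_self)
  from positive_operator_Cauchy_Schwarz[OF this, of x y]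
  have "(cmod (cinner x y))\<^sup>2 \<le> (norm x * norm y)\<^sup>2"
    by (simp add: cinner_self power_mult_distrib)
  then show ?thesis by (simp add: power2_le_iff_abs_le)
qed

lemma bounded_linear_cinner_right: "bounded_linear (cinner x)"
proof (rule bounded_linear_intro[where K = "norm x"])
  show "cinner x (r *\<^sub>R y) = r *\<^sub>R cinner x y" for r y
    by (metis cinner_scaleC_right scaleC_of_real scaleR_conv_of_real)
  show "norm (cinner x y) \<le> norm y * norm x" for y
    using cinner_Cauchy_Schwarz[of x y] by (simp add: mult.commute)
qed (rule cinner_add_right)

lemma bounded_linear_scaleC_left: "bounded_linear (\<lambda>c. c *\<^sub>C (x::'a::chilbert_space))"
proof (rule bounded_linear_intro[where K = "norm x"])
  show "(r *\<^sub>R c) *\<^sub>C x = r *\<^sub>R (c *\<^sub>C x)" for r c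
    by (metis scaleC_scaleC scaleC_of_real scaleR_conv_of_real)
qed (simp_all add: scaleC_add_left norm_scaleC)

lemma bounded_linear_scaleC_right: "bounded_linear (\<lambda>x. c *\<^sub>C (x::'a::chilbert_space))"
proof (rule bounded_linear_intro[where K = "cmod c"])
  show "c *\<^sub>C (r *\<^sub>R x) = r *\<^sub>R (c *\<^sub>C x)" for r x
    by (simp add: scaleC_of_real[symmetric] scaleC_scaleC mult.commute)
qed (simp_all add: scaleC_add_right norm_scaleC mult.commute)

lemma cinner_scaleR_right: "cinner x (r *\<^sub>R y) = complex_of_real r * cinner x y"
  by (simp add: scaleC_of_real[symmetric] cinner_scaleC_right)

text \<open>Turns a quadratic condition on \<open>x\<close> into a linear one. Cauchy-Schwarz for
  the pair \<open>T x\<close>, \<open>x\<close> bounds the fourth power of \<open>norm (T x)\<close>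
  by a multiple of the form at \<open>x\<close>.\<close>

lemma positive_operator_eq_zero_iff:
  assumes "positive_operator T"
  shows "cinner x (T x) = 0 \<longleftrightarrow> T x = 0"
proof
  assume "cinner x (T x) = 0"
  then have "(cmod (cinner (T x) (T x)))\<^sup>2 \<le> 0"
    using positive_operator_Cauchy_Schwarz[OF assms, of "T x" x] by simp
  then show "T x = 0" by simp
qed simp


subsection \<open>Compact operators\<close>

text \<open>Total boundedness of the image of the unit ball; by completeness of the codomain this is
  relative compactness. Finite nets make sums, compositions and norm limits elementary.\<close>

definition compact_operator :: "('a::chilbert_space \<Rightarrow> 'b::chilbert_space) \<Rightarrow> bool"
  where "compact_operator T \<longleftrightarrow>
    (\<forall>e>0. \<exists>k. finite k \<and> T ` cball 0 1 \<subseteq> (\<Union>y\<in>k. ball y e))"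

lemma compact_operatorI:
  assumes "\<And>e. e > 0 \<Longrightarrow> \<exists>k. finite k \<and> (\<forall>x. norm x \<le> 1 \<longrightarrow> (\<exists>y\<in>k. dist y (T x) < e))"
  shows "compact_operator T"
  unfolding compact_operator_def
proof (intro allI impI)
  fix e :: real assume "e > 0"
  from assms[OF this] obtain k where "finite k" "\<forall>x. norm x \<le> 1 \<longrightarrow> (\<exists>y\<in>k. dist y (T x) < e)"
    by blast
  then show "\<exists>k. finite k \<and> T ` cball 0 1 \<subseteq> (\<Union>y\<in>k. ball y e)"
    by (intro exI[of _ k]) auto
qed

lemma compact_operatorE:
  assumes "compact_operator T" "e > 0"
  obtains k where "finite k" "\<And>x. norm x \<le> 1 \<Longrightarrow> \<exists>y\<in>k. dist y (T x) < e"
proof -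
  obtain k where "finite k" and k: "T ` cball 0 1 \<subseteq> (\<Union>y\<in>k. ball y e)"
    using assms unfolding compact_operator_def by blast
  moreover have "\<exists>y\<in>k. dist y (T x) < e" if "norm x \<le> 1" for x
  proof -
    have "T x \<in> T ` cball 0 1" using that by simp
    then show ?thesis using k by (auto simp: subset_iff)
  qed
  ultimately show ?thesis using that by blast
qed

lemma compact_operator_add:
  assumes "compact_operator S" and "compact_operator T"
  shows "compact_operator (\<lambda>x. S x + T x)"
proof (rule compact_operatorI)
  fix e :: real assume "e > 0"
  then have e: "e / 2 > 0" by simp
  obtain k where k: "finite k" "\<And>x. norm x \<le> 1 \<Longrightarrow> \<exists>y\<in>k. dist y (S x) < e / 2"
    using compact_operatorE[OF assms(1) e] by blast
  obtain l where l: "finite l" "\<And>x. norm x \<le> 1 \<Longrightarrow> \<exists>y\<in>l. dist y (T x) < e / 2"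
    using compact_operatorE[OF assms(2) e] by blast
  show "\<exists>k. finite k \<and> (\<forall>x. norm x \<le> 1 \<longrightarrow> (\<exists>y\<in>k. dist y (S x + T x) < e))"
  proof (intro exI conjI allI impI)
    show "finite ((\<lambda>(y, z). y + z) ` (k \<times> l))" using k l by simp
    fix x :: 'a assume "norm x \<le> 1"
    then obtain y z where "y \<in> k" "dist y (S x) < e / 2" "z \<in> l" "dist z (T x) < e / 2"
      using k(2) l(2) by blast
    then have "dist (y + z) (S x + T x) < e"
      using dist_triangle_add[of y z "S x" "T x"] by simp
    then show "\<exists>w\<in>(\<lambda>(y, z). y + z) ` (k \<times> l). dist w (S x + T x) < e"
      using \<open>y \<in> k\<close> \<open>z \<in> l\<close> by force
  qed
qed

lemma compact_operator_zero: "compact_operator (\<lambda>x. 0)"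
  by (rule compact_operatorI) (auto intro!: exI[of _ "{0}"])

lemma compact_operator_sum:
  assumes "\<And>i. i \<in> I \<Longrightarrow> compact_operator (T i)"
  shows "compact_operator (\<lambda>x. \<Sum>i\<in>I. T i x)"
  using assms
  by (induction I rule: infinite_finite_induct)
    (simp_all add: compact_operator_zero compact_operator_add)

lemma compact_operator_compose_left:
  assumes "compact_operator T" and "bounded_linear L"
  shows "compact_operator (\<lambda>x. L (T x))"
proof (rule compact_operatorI)
  fix e :: real assume "e > 0"
  interpret L: bounded_linear L by fact
  obtain K where K: "K > 0" "\<And>x. norm (L x) \<le> norm x * K" using L.pos_bounded by blast
  obtain k where k: "finite k" "\<And>x. norm x \<le> 1 \<Longrightarrow> \<exists>y\<in>k. dist y (T x) < e / K"
    using compact_operatorE[OF assms(1), of "e / K"] \<open>e > 0\<close> K(1) by auto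
  have "\<exists>y\<in>L ` k. dist y (L (T x)) < e" if x: "norm x \<le> 1" for x
  proof -
    obtain y where "y \<in> k" "norm (y - T x) < e / K"
      using k(2)[OF x] by (auto simp: dist_norm)
    then have "norm (L y - L (T x)) < e"
      using K(2)[of "y - T x"] K(1) by (simp add: L.diff field_simps)
    then show ?thesis using \<open>y \<in> k\<close> by (auto simp: dist_norm)
  qed
  then show "\<exists>k. finite k \<and> (\<forall>x. norm x \<le> 1 \<longrightarrow> (\<exists>y\<in>k. dist y (L (T x)) < e))"
    using k(1) by blast
qed

lemma compact_operator_compose_right:
  assumes "compact_operator T" and "bounded_linear T" and "bounded_linear R"
  shows "compact_operator (\<lambda>x. T (R x))"
proof (rule compact_operatorI)
  fix e :: real assume "e > 0"
  interpret T: bounded_linear T by fact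
  obtain K where K: "K > 0" "\<And>x. norm (R x) \<le> norm x * K"
    using bounded_linear.pos_bounded[OF assms(3)] by blast
  obtain k where k: "finite k" "\<And>x. norm x \<le> 1 \<Longrightarrow> \<exists>y\<in>k. dist y (T x) < e / K"
    using compact_operatorE[OF assms(1), of "e / K"] \<open>e > 0\<close> K(1) by auto
  \<comment> \<open>\<open>R\<close> maps the unit ball into the ball of radius \<open>K\<close>, so
    an \<open>e / K\<close> net for \<open>T\<close> on the unit ball is stretched by
    \<open>K\<close>.\<close>
  have "\<exists>y\<in>(\<lambda>y. K *\<^sub>R y) ` k. dist y (T (R x)) < e" if "norm x \<le> 1" for x
  proof -
    have "norm x * K \<le> K" using that K(1) by (simp add: mult_left_le_one_le)
    then have "norm (R x) \<le> K" using K(2)[of x] by linarith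
    then have "norm (R x /\<^sub>R K) \<le> 1" using K(1) by (simp add: field_simps)
    then obtain y where "y \<in> k" and y: "norm (y - T (R x /\<^sub>R K)) < e / K"
      using k(2) unfolding dist_norm by blast
    have "K *\<^sub>R y - T (R x) = K *\<^sub>R (y - T (R x /\<^sub>R K))"
      using K(1) by (simp add: T.scaleR scaleR_right_diff_distrib)
    then have "norm (K *\<^sub>R y - T (R x)) = K * norm (y - T (R x /\<^sub>R K))"
      using K(1) by (simp only: norm_scaleR abs_of_pos)
    with y have "norm (K *\<^sub>R y - T (R x)) < e"
      using K(1) by (simp only: pos_less_divide_eq mult.commute)
    then show ?thesis using \<open>y \<in> k\<close> by (auto simp: dist_norm)
  qed
  then show "\<exists>k. finite k \<and> (\<forall>x. norm x \<le> 1 \<longrightarrow> (\<exists>y\<in>k. dist y (T (R x)) < e))"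
    using k(1) by blast
qed

text \<open>The image of the unit ball lies in the continuous image of a compact disc of
  scalars.\<close>

lemma compact_operator_rank_one: "compact_operator (\<lambda>x. cinner b x *\<^sub>C w)"
  unfolding compact_operator_def
proof (intro allI impI)
  fix e :: real assume "e > 0"
  have "compact ((\<lambda>c. c *\<^sub>C w) ` cball 0 (norm b))"
    by (intro compact_continuous_image linear_continuous_on bounded_linear_scaleC_left) simp
  then obtain k where k: "finite k" "(\<lambda>c. c *\<^sub>C w) ` cball 0 (norm b) \<subseteq> (\<Union>y\<in>k. ball y e)"
    using \<open>e > 0\<close> unfolding compact_eq_totally_bounded by blast
  have "cmod (cinner b x) \<le> norm b" if "norm x \<le> 1" for x
    using cinner_Cauchy_Schwarz[of b x] mult_left_le[OF that, of "norm b"] by simp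
  then have "(\<lambda>x. cinner b x *\<^sub>C w) ` cball 0 1 \<subseteq> (\<lambda>c. c *\<^sub>C w) ` cball 0 (norm b)"
    by auto
  then show "\<exists>k. finite k \<and> (\<lambda>x. cinner b x *\<^sub>C w) ` cball 0 1 \<subseteq> (\<Union>y\<in>k. ball y e)"
    using k by blast
qed

text \<open>A net of mesh \<open>e / 2\<close> for an approximation \<open>S\<close> within
  \<open>e / 2\<close> is a net of mesh \<open>e\<close> for \<open>T\<close>.\<close>

lemma compact_operator_limit:
  assumes "\<And>e. e > 0 \<Longrightarrow>
    \<exists>S. compact_operator S \<and> (\<forall>x. norm x \<le> 1 \<longrightarrow> norm (S x - T x) \<le> e)"
  shows "compact_operator T"
proof (rule compact_operatorI)
  fix e :: real assume "e > 0"
  then have e: "e / 2 > 0" by simp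
  obtain S where S: "compact_operator S" "\<And>x. norm x \<le> 1 \<Longrightarrow> norm (S x - T x) \<le> e / 2"
    using assms[OF e] by blast
  obtain k where k: "finite k" "\<And>x. norm x \<le> 1 \<Longrightarrow> \<exists>y\<in>k. dist y (S x) < e / 2"
    using compact_operatorE[OF S(1) e] by blast
  have "\<exists>y\<in>k. dist y (T x) < e" if x: "norm x \<le> 1" for x
  proof -
    obtain y where "y \<in> k" "dist y (S x) < e / 2" using k(2)[OF x] by blast
    moreover have "dist (S x) (T x) \<le> e / 2" using S(2)[OF x] by (simp add: dist_norm)
    ultimately show ?thesis using dist_triangle[of y "T x" "S x"] by force
  qed
  then show "\<exists>k. finite k \<and> (\<forall>x. norm x \<le> 1 \<longrightarrow> (\<exists>y\<in>k. dist y (T x) < e))"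
    using k(1) by blast
qed

lemma compact_operator_convergent_subseq:
  assumes "compact_operator T" and "\<And>n. norm (x n) \<le> 1"
  obtains r l where "strict_mono (r :: nat \<Rightarrow> nat)" and "(\<lambda>n. T (x (r n))) \<longlonglongrightarrow> l"
proof -
  have "compact (closure (T ` cball 0 1))"
    unfolding compact_eq_totally_bounded
  proof (intro conjI allI impI)
    show "complete (closure (T ` cball 0 1))" by (simp add: complete_eq_closed)
    fix e :: real assume "e > 0"
    then obtain k where k: "finite k" "T ` cball 0 1 \<subseteq> (\<Union>y\<in>k. ball y (e / 2))"
      using assms(1) unfolding compact_operator_def by (meson half_gt_zero)
    \<comment> \<open>Taking the closure turns open balls into closed ones; starting from radius
      \<open>e / 2\<close> leaves room to return to open balls of radius \<open>e\<close>.\<close>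
    have "closure (T ` cball 0 1) \<subseteq> (\<Union>y\<in>k. cball y (e / 2))"
      using k by (intro closure_minimal) (auto simp: subset_iff intro: less_imp_le)
    also have "\<dots> \<subseteq> (\<Union>y\<in>k. ball y e)"
      using \<open>e > 0\<close> by (intro UN_mono) auto
    finally show "\<exists>k. finite k \<and> closure (T ` cball 0 1) \<subseteq> (\<Union>y\<in>k. ball y e)"
      using k(1) by blast
  qed
  moreover have "T (x n) \<in> closure (T ` cball 0 1)" for n
    using assms(2) closure_subset by fastforce
  ultimately show ?thesis
    using that by (fastforce simp: compact_def o_def)
qed


subsection \<open>Supports of compact positive operators\<close>

text \<open>The core of the spectral theorem. The orthogonal complement \<open>M\<close> of the
  eigenvectors with nonzero eigenvalue is invariant under \<open>T\<close>. If \<open>T\<close> were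
  nonzero on \<open>M\<close>, compactness would let the norm of the restriction be attained, which
  yields such an eigenvector inside \<open>M\<close>, orthogonal to itself.\<close>

lemma compact_selfadjoint_zero_orthogonal_eigenvectors:
  assumes T: "bounded_clinear T" and comp: "compact_operator T"
    and sa: "\<And>x y. cinner (T x) y = cinner x (T y)"
    and y: "\<And>v c. c \<noteq> 0 \<Longrightarrow> T v = c *\<^sub>C v \<Longrightarrow> cinner v y = 0"
  shows "T y = 0"
proof (rule ccontr)
  assume "T y \<noteq> 0"
  have lin: "clinear T" and bl: "bounded_linear T" using T by (auto simp: bounded_clinear_def)
  interpret T: bounded_linear T by (fact bl)
  define M where "M = {y. \<forall>v c. c \<noteq> 0 \<longrightarrow> T v = c *\<^sub>C v \<longrightarrow> cinner v y = 0}"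
  have yM: "y \<in> M" using y by (simp add: M_def)
  have TM: "T z \<in> M" if "z \<in> M" for z
    using that unfolding M_def by (auto simp: sa[symmetric] cinner_scaleC_left)
  have scaleM: "r *\<^sub>R z \<in> M" if "z \<in> M" for r z
    using that unfolding M_def by (auto simp: cinner_scaleR_right)
  have diffM: "z - w \<in> M" if "z \<in> M" "w \<in> M" for z w
    using that unfolding M_def by (auto simp: cinner_diff_right)
  have closedM: "closed M"
  proof -
    have "M = (\<Inter>v\<in>{v. \<exists>c. c \<noteq> 0 \<and> T v = c *\<^sub>C v}. cinner v -` {0})"
      by (auto simp: M_def)
    moreover have "closed (cinner v -` {0})" for v :: 'a
      by (intro continuous_closed_vimage linear_continuous_at bounded_linear_cinner_right) simp
    ultimately show ?thesis by auto
  qed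
  obtain K where K: "\<And>x. norm (T x) \<le> norm x * K" "K > 0" using T.pos_bounded by blast
  \<comment> \<open>\<open>s\<close> is the operator norm of the restriction of \<open>T\<close> to
    \<open>M\<close>.\<close>
  define X where "X = {norm (T z) |z. z \<in> M \<and> norm z \<le> 1}"
  define s where "s = Sup X"
  have bdd: "bdd_above X"
  proof (rule bdd_aboveI)
    fix a assume "a \<in> X"
    then obtain z where "a = norm (T z)" "norm z \<le> 1" by (auto simp: X_def)
    then show "a \<le> K" using K(1)[of z] K(2) mult_right_mono[of "norm z" 1 K] by linarith
  qed
  have Tle: "norm (T z) \<le> s * norm z" if "z \<in> M" for z
  proof (cases "z = 0")
    case False
    have "norm (T (z /\<^sub>R norm z)) \<in> X"
      unfolding X_def using scaleM[OF that] False by (intro CollectI exI conjI refl) auto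
    then have "norm (T (z /\<^sub>R norm z)) \<le> s" unfolding s_def using bdd by (rule cSup_upper)
    then show ?thesis using False by (simp add: T.scaleR field_simps)
  qed (simp add: T.zero)
  have "s > 0"
  proof (rule ccontr)
    assume "\<not> s > 0"
    then have "s * norm y \<le> 0" by (simp add: mult_nonpos_nonneg)
    then have "norm (T y) \<le> 0" using Tle[OF yM] by linarith
    then show False using \<open>T y \<noteq> 0\<close> by simp
  qed
  \<comment> \<open>A maximizing sequence for that norm in the unit ball of
    \<open>M\<close>.\<close>
  have "\<exists>z. z \<in> M \<and> norm z \<le> 1 \<and> s - inverse (real (Suc n)) < norm (T z)" for n
  proof -
    have "X \<noteq> {}" unfolding X_def using scaleM[OF yM, of 0] by force
    moreover have "s - inverse (real (Suc n)) < Sup X" by (simp add: s_def)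
    ultimately obtain a where "a \<in> X" "s - inverse (real (Suc n)) < a"
      using less_cSupD by blast
    then show ?thesis by (auto simp: X_def)
  qed
  then obtain z where z: "\<And>n. z n \<in> M" "\<And>n. norm (z n) \<le> 1"
    "\<And>n. s - inverse (real (Suc n)) < norm (T (z n))"
    by metis
  have Tz: "norm (T (z n)) \<le> s" for n
    using Tle[OF z(1)] z(2)[of n] \<open>s > 0\<close> by (smt (verit) mult_left_le)
  have "(\<lambda>n. s - inverse (real (Suc n))) \<longlonglongrightarrow> s - 0"
    by (intro tendsto_diff tendsto_const LIMSEQ_inverse_real_of_nat)
  then have lower: "(\<lambda>n. s - inverse (real (Suc n))) \<longlonglongrightarrow> s" by simp
  have ev1: "eventually (\<lambda>n. s - inverse (real (Suc n)) \<le> norm (T (z n))) sequentially"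
    by (intro always_eventually allI less_imp_le[OF z(3)])
  have ev2: "eventually (\<lambda>n. norm (T (z n)) \<le> s) sequentially"
    by (intro always_eventually allI Tz)
  have lim_s: "(\<lambda>n. norm (T (z n))) \<longlonglongrightarrow> s"
    by (rule tendsto_sandwich[OF ev1 ev2 lower tendsto_const])
  obtain r l where r: "strict_mono r" "(\<lambda>n. T (z (r n))) \<longlonglongrightarrow> l"
    using compact_operator_convergent_subseq[where x = z, OF comp z(2)] by blast
  \<comment> \<open>Almost maximizers of \<open>norm (T w)\<close> are almost eigenvectors of \<open>T\<^sup>2\<close>; compactness makes a subsequence converge.\<close>
  have near: "(norm (T (T w) - s\<^sup>2 *\<^sub>R w))\<^sup>2 \<le> s\<^sup>2 * (s\<^sup>2 - (norm (T w))\<^sup>2)"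
    if w: "w \<in> M" "norm w \<le> 1" for w
  proof -
    have "complex_of_real ((norm (T (T w) - s\<^sup>2 *\<^sub>R w))\<^sup>2)
        = cinner (T (T w) - s\<^sup>2 *\<^sub>R w) (T (T w) - s\<^sup>2 *\<^sub>R w)"
      by (simp only: cinner_self)
    also have "\<dots> = cinner (T (T w)) (T (T w)) - 2 * complex_of_real (s\<^sup>2) * cinner (T w) (T w)
        + (complex_of_real (s\<^sup>2))\<^sup>2 * cinner w w"
      unfolding scaleC_of_real[symmetric]
      by (simp add: cinner_diff_left cinner_diff_right cinner_scaleC_left cinner_scaleC_right
          sa[of "T w" w] sa[of w "T w", symmetric] algebra_simps power2_eq_square)
    also have "\<dots> = complex_of_real ((norm (T (T w)))\<^sup>2 - 2 * s\<^sup>2 * (norm (T w))\<^sup>2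
        + (s\<^sup>2)\<^sup>2 * (norm w)\<^sup>2)"
      by (simp add: cinner_self)
    finally have "(norm (T (T w) - s\<^sup>2 *\<^sub>R w))\<^sup>2 = (norm (T (T w)))\<^sup>2 - 2 * s\<^sup>2 * (norm (T w))\<^sup>2
        + (s\<^sup>2)\<^sup>2 * (norm w)\<^sup>2"
      using of_real_eq_iff by blast
    moreover have "(norm (T (T w)))\<^sup>2 \<le> s\<^sup>2 * (norm (T w))\<^sup>2"
      using power_mono[OF Tle[OF TM[OF w(1)]], of 2] by (simp add: power_mult_distrib)
    moreover have "(s\<^sup>2)\<^sup>2 * (norm w)\<^sup>2 \<le> (s\<^sup>2)\<^sup>2"
      using w(2) by (simp add: mult_left_le power_le_one)
    ultimately show ?thesis by (simp add: algebra_simps power2_eq_square)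
  qed
  have "(\<lambda>n. s\<^sup>2 * (s\<^sup>2 - (norm (T (z n)))\<^sup>2)) \<longlonglongrightarrow> s\<^sup>2 * (s\<^sup>2 - s\<^sup>2)"
    by (intro tendsto_intros lim_s)
  then have "(\<lambda>n. s\<^sup>2 * (s\<^sup>2 - (norm (T (z n)))\<^sup>2)) \<longlonglongrightarrow> 0" by simp
  then have "(\<lambda>n. (norm (T (T (z n)) - s\<^sup>2 *\<^sub>R z n))\<^sup>2) \<longlonglongrightarrow> 0"
    by (rule Lim_null_comparison[rotated, OF _ always_eventually])
      (use near[OF z(1,2)] in simp)
  then have "(\<lambda>n. sqrt ((norm (T (T (z n)) - s\<^sup>2 *\<^sub>R z n))\<^sup>2)) \<longlonglongrightarrow> sqrt 0"
    by (rule tendsto_real_sqrt)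
  then have d0: "(\<lambda>n. T (T (z n)) - s\<^sup>2 *\<^sub>R z n) \<longlonglongrightarrow> 0"
    by (simp add: tendsto_norm_zero_iff)
  \<comment> \<open>The left side is just \<open>z (r n)\<close>, written through two sequences
    known to converge; so the maximizing subsequence itself converges.\<close>
  have "(\<lambda>n. (1 / s\<^sup>2) *\<^sub>R (T (T (z (r n))) - (T (T (z (r n))) - s\<^sup>2 *\<^sub>R z (r n))))
      \<longlonglongrightarrow> (1 / s\<^sup>2) *\<^sub>R (T l - 0)"
    using LIMSEQ_subseq_LIMSEQ[OF d0 r(1)]
    by (intro tendsto_intros T.tendsto r(2)) (simp add: o_def)
  then have zl: "(\<lambda>n. z (r n)) \<longlonglongrightarrow> (1 / s\<^sup>2) *\<^sub>R T l"
    using \<open>s > 0\<close> by simp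
  define w where "w = (1 / s\<^sup>2) *\<^sub>R T l"
  have "T w = l" using LIMSEQ_unique[OF T.tendsto[OF zl] r(2)] by (simp add: w_def)
  then have TTw: "T (T w) = s\<^sup>2 *\<^sub>R w" using \<open>s > 0\<close> by (simp add: w_def)
  have wM: "w \<in> M"
    using closed_sequentially[OF closedM _ zl] z(1) by (simp add: w_def)
  have "norm (T w) = s"
    using LIMSEQ_unique[OF tendsto_norm[OF r(2)] LIMSEQ_subseq_LIMSEQ[OF lim_s r(1), unfolded o_def]]
    by (simp add: \<open>T w = l\<close>)
  then have "w \<noteq> 0" using \<open>s > 0\<close> by (auto simp: T.zero)
  \<comment> \<open>An eigenvector in \<open>M\<close> with nonzero eigenvalue is orthogonal to
    itself.\<close>
  have none: "v = 0" if "v \<in> M" "a \<noteq> 0" "T v = a *\<^sub>R v" for v a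
  proof -
    have "T v = complex_of_real a *\<^sub>C v" using that(3) by (simp add: scaleC_of_real)
    moreover have orth: "\<forall>u c. c \<noteq> 0 \<longrightarrow> T u = c *\<^sub>C u \<longrightarrow> cinner u v = 0"
      using that(1) by (simp add: M_def)
    ultimately have "cinner v v = 0"
      using that(2) by (intro orth[rule_format, of "complex_of_real a" v]) auto
    then show ?thesis by simp
  qed
  \<comment> \<open>From \<open>T (T w) = s\<^sup>2 *\<^sub>R w\<close>, the vector
    \<open>T w - s *\<^sub>R w\<close> satisfies the eigenvalue equation for \<open>- s\<close>,
    hence vanishes; then \<open>w\<close> satisfies it for \<open>s\<close> and vanishes
    too.\<close>
  have "T w - s *\<^sub>R w = 0"
    using \<open>s > 0\<close> by (intro none[of _ "- s"])
      (auto intro: diffM TM scaleM wM simp: T.diff T.scaleR TTw power2_eq_square algebra_simps)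
  then have "w = 0"
    using \<open>s > 0\<close> by (intro none[of _ s]) (auto intro: wM)
  then show False using \<open>w \<noteq> 0\<close> by simp
qed

text \<open>Replaces supports by a condition that is additive in \<open>T\<close>. If the support
  lies in the range, a vector of the kernel is orthogonal to all eigenvectors with nonzero
  eigenvalue, so \<open>T\<close> kills it. Conversely, the kernel component \<open>w\<close> of
  such an eigenvector \<open>v\<close> has \<open>T w = 0\<close>; self-adjointness makes
  \<open>w\<close> orthogonal to \<open>v\<close> and to \<open>P v\<close>, hence to
  itself.\<close>

lemma satisfies_iff_vanishes_on_kernel:
  assumes T: "positive_operator T" and comp: "compact_operator T" and P: "is_projection P"
  shows "T \<Turnstile> P \<longleftrightarrow> (\<forall>x. P x = 0 \<longrightarrow> cinner x (T x) = 0)"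
proof
  have bT: "bounded_clinear T" using T by (simp add: positive_operator_def)
  have bP: "bounded_linear P" and lP: "clinear P" and PP: "\<And>x. P (P x) = P x"
    and saP: "\<And>x y. cinner (P x) y = cinner x (P y)"
    using P by (auto simp: is_projection_def bounded_clinear_def)
  have saT: "cinner (T x) y = cinner x (T y)" for x y by (rule positive_operator_selfadjoint[OF T])
  have rangeP: "range P = {x. P x = x}" using PP by (auto simp: image_iff) metis
  {
    assume "T \<Turnstile> P"
    then have sub: "supp T \<subseteq> {x. P x = x}" by (simp add: satisfies_def rangeP)
    show "\<forall>x. P x = 0 \<longrightarrow> cinner x (T x) = 0"
    proof (intro allI impI)
      fix x assume x: "P x = 0"
      have "T x = 0"
      proof (rule compact_selfadjoint_zero_orthogonal_eigenvectors[OF bT comp saT])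
        fix v c assume "c \<noteq> 0" "T v = c *\<^sub>C v"
        have "P v = v"
        \<comment> \<open>The zero vector is not among the generators of
          \<open>supp\<close>.\<close>
        proof (cases "v = 0")
          case False
          then have "v \<in> supp T"
            unfolding supp_def using \<open>c \<noteq> 0\<close> \<open>T v = c *\<^sub>C v\<close>
            by (intro subsetD[OF closure_subset] chilbert.span_base) auto
          then show ?thesis using sub by auto
        qed (simp add: clinear_zero[OF lP])
        then have "cinner v x = cinner (P v) x" by simp
        then show "cinner v x = 0" by (simp add: saP x)
      qed
      then show "cinner x (T x) = 0" by simp
    qed
  next
    assume ker: "\<forall>x. P x = 0 \<longrightarrow> cinner x (T x) = 0"
    have "P v = v" if "c \<noteq> 0" "T v = c *\<^sub>C v" for v c
    proof -
      define w where "w = v - P v"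
      have Pw: "P w = 0" by (simp add: w_def clinear_diff[OF lP] PP)
      then have "T w = 0" using ker positive_operator_eq_zero_iff[OF T] by blast
      then have "c * cinner w v = 0"
        using saT[of w v] that by (simp add: cinner_scaleC_right)
      moreover have "cinner w (P v) = 0" using saP[of w v] Pw by simp
      ultimately have "cinner w w = 0"
        using that(1) by (subst (2) w_def) (simp add: cinner_diff_right)
      then show ?thesis by (simp add: w_def)
    qed
    moreover have "chilbert.subspace {x. P x = x}"
      by (auto simp: chilbert.subspace_def clinear_zero[OF lP] clinear_add[OF lP] clinear_scaleC[OF lP])
    moreover have "closed {x. P x = x}"
      by (intro closed_Collect_eq linear_continuous_on[OF bP] continuous_on_id)
    ultimately have "supp T \<subseteq> {x. P x = x}"
      unfolding supp_def by (intro closure_minimal chilbert.span_minimal) auto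
    then show "T \<Turnstile> P" by (simp add: satisfies_def rangeP)
  }
qed

text \<open>Composing \<rho> with the projection onto finitely many basis vectors gives a finite
  rank operator, and its distance from \<rho> is controlled by the tail of the convergent
  trace.\<close>

lemma density_operator_compact:
  assumes "density_operator \<rho>"
  shows "compact_operator \<rho>"
proof (rule compact_operator_limit)
  fix e :: real assume "e > 0"
  obtain B where pos: "positive_operator \<rho>" and B: "orthonormal_basis B"
    and hs: "((\<lambda>b. cinner b (\<rho> b)) has_sum 1) B"
    using assms by (auto simp: density_operator_def)
  have lin: "clinear \<rho>" and bl: "bounded_linear \<rho>"
    using pos by (auto simp: positive_operator_def bounded_clinear_def)
  have ge0: "Re (cinner z (\<rho> z)) \<ge> 0" for z
    using pos by (auto simp: positive_operator_def complex_nonneg_Reals_iff)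
  have on: "cinner b c = (if b = c then 1 else 0)" if "b \<in> B" "c \<in> B" for b c
    using B that by (auto simp: orthonormal_basis_def)
  define f where "f b = Re (cinner b (\<rho> b))" for b
  have f0: "f b \<ge> 0" for b by (simp add: f_def ge0)
  obtain K where K: "K > 0" "\<And>x. norm (\<rho> x) \<le> norm x * K"
    using bounded_linear.pos_bounded[OF bl] by blast
  \<comment> \<open>Chosen so that \<open>K * \<epsilon>\<close> is the squared error allowed at the
    end.\<close>
  define \<epsilon> where "\<epsilon> = e\<^sup>2 / K"
  have "\<epsilon> > 0" using \<open>e > 0\<close> K by (simp add: \<epsilon>_def)
  have hf: "(f has_sum 1) B" using has_sum_Re[OF hs] by (simp add: f_def[abs_def])
  obtain F where F: "finite F" "F \<subseteq> B" "dist (sum f F) 1 \<le> \<epsilon>"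
    using has_sum_finite_approximation[OF hf \<open>\<epsilon> > 0\<close>] by blast
  have tail: "sum f H \<le> \<epsilon>" if "finite H" "H \<subseteq> B - F" for H
  proof -
    have "sum f (F \<union> H) \<le> 1"
      using F that by (intro finite_sum_le_has_sum[OF hf]) (auto simp: f0)
    moreover have "sum f (F \<union> H) = sum f F + sum f H"
      using F that by (intro sum.union_disjoint) auto
    ultimately show ?thesis using F(3) by (auto simp: dist_real_def)
  qed
  \<comment> \<open>Cauchy-Schwarz for the pair \<open>\<rho> y\<close>, \<open>y\<close>, where
    \<open>K\<close> bounds the form at \<open>\<rho> y\<close>; one factor
    \<open>(norm (\<rho> y))\<^sup>2\<close> cancels.\<close>
  have small: "(norm (\<rho> y))\<^sup>2 \<le> K * Re (cinner y (\<rho> y))" for y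
  proof (cases "\<rho> y = 0")
    case False
    have "Re (cinner (\<rho> y) (\<rho> (\<rho> y))) \<le> norm (\<rho> y) * (norm (\<rho> y) * K)"
      using complex_Re_le_cmod cinner_Cauchy_Schwarz K(2)[of "\<rho> y"]
      by (meson mult_left_mono norm_ge_zero order_trans)
    then have "((norm (\<rho> y))\<^sup>2)\<^sup>2 \<le> (norm (\<rho> y) * (norm (\<rho> y) * K)) * Re (cinner y (\<rho> y))"
      using positive_operator_Cauchy_Schwarz[OF pos, of "\<rho> y" y] mult_right_mono[OF _ ge0[of y]]
      by (fastforce simp: cinner_self norm_power)
    then have "(norm (\<rho> y))\<^sup>2 * (norm (\<rho> y))\<^sup>2 \<le> (norm (\<rho> y))\<^sup>2 * (K * Re (cinner y (\<rho> y)))"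
      by (simp add: power2_eq_square mult_ac)
    then show ?thesis using False by (simp only: mult_le_cancel_left_pos zero_less_power2 norm_eq_zero not_False_eq_True)
  qed (use K ge0 in simp)
  define S where "S x = (\<Sum>b\<in>F. cinner b x *\<^sub>C \<rho> b)" for x
  have compS: "compact_operator S"
    unfolding S_def[abs_def] by (intro compact_operator_sum compact_operator_rank_one)
  \<comment> \<open>The error bound is first shown for finite combinations of basis vectors; both
    sides being continuous, density extends it to all \<open>x\<close>.\<close>
  have span_bound: "(norm (S x - \<rho> x))\<^sup>2 \<le> e\<^sup>2 * (norm x)\<^sup>2" if x_span: "x \<in> cspan B" for x
  proof -
    obtain G c where G: "finite G" "G \<subseteq> B" and x: "x = (\<Sum>b\<in>G. c b *\<^sub>C b)"
      using x_span unfolding chilbert.span_explicit by blast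
    have coef: "cinner b x = (if b \<in> G then c b else 0)" if "b \<in> B" for b
    proof -
      have "cinner b x = (\<Sum>a\<in>G. if b = a then c a else 0)"
        unfolding x cinner_sum_right cinner_scaleC_right
        using G that by (intro sum.cong) (auto simp: on)
      then show ?thesis using G by simp
    qed
    define H where "H = G - F"
    have H: "finite H" "H \<subseteq> B - F" "H \<subseteq> G" using G by (auto simp: H_def)
    \<comment> \<open>\<open>y\<close> is the component of \<open>x\<close> off \<open>F\<close>, so
      the error is \<open>\<rho> y\<close> up to sign.\<close>
    define y where "y = (\<Sum>b\<in>H. c b *\<^sub>C b)"
    have "(\<Sum>b\<in>F. cinner b x *\<^sub>C b) = (\<Sum>b\<in>F. if b \<in> G then c b *\<^sub>C b else 0)"
      using F by (intro sum.cong) (auto simp: coef)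
    also have "\<dots> = (\<Sum>b\<in>G \<inter> F. c b *\<^sub>C b)"
      using F by (simp add: sum.inter_restrict[symmetric] Int_commute)
    finally have "x - (\<Sum>b\<in>F. cinner b x *\<^sub>C b) = y"
      unfolding y_def H_def x using sum.Int_Diff[OF G(1), of "\<lambda>b. c b *\<^sub>C b" F] by simp
    moreover have "S x = \<rho> (\<Sum>b\<in>F. cinner b x *\<^sub>C b)"
      by (simp add: S_def clinear_sum[OF lin] clinear_scaleC[OF lin])
    ultimately have "\<rho> y = \<rho> x - S x" by (simp add: clinear_diff[OF lin, symmetric])
    then have Sy: "norm (S x - \<rho> x) = norm (\<rho> y)" by (simp add: norm_minus_commute)
    have "cinner x x = (\<Sum>b\<in>G. complex_of_real ((cmod (c b))\<^sup>2))"
    proof -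
      have "cinner x x = (\<Sum>b\<in>G. cnj (c b) * cinner b x)"
        by (subst (1) x) (simp add: cinner_sum_left cinner_scaleC_left)
      also have "\<dots> = (\<Sum>b\<in>G. complex_of_real ((cmod (c b))\<^sup>2))"
        using G by (intro sum.cong refl) (auto simp: coef complex_norm_square mult.commute simp del: of_real_power)
      finally show ?thesis .
    qed
    then have "complex_of_real ((norm x)\<^sup>2) = complex_of_real (\<Sum>b\<in>G. (cmod (c b))\<^sup>2)"
      by (simp only: cinner_self of_real_sum)
    then have nx: "(norm x)\<^sup>2 = (\<Sum>b\<in>G. (cmod (c b))\<^sup>2)" using of_real_eq_iff by blast
    \<comment> \<open>Off-diagonal entries are dominated by diagonal ones. A second Cauchy-Schwarz,
      for the sums over \<open>H\<close>, then leaves only a tail of the trace.\<close>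
    have offdiag: "cmod (cinner a (\<rho> b)) \<le> sqrt (f a) * sqrt (f b)" for a b
      using positive_operator_Cauchy_Schwarz[OF pos, of a b]
      by (simp add: f_def real_le_rsqrt real_sqrt_mult[symmetric])
    have "cinner y (\<rho> y) = (\<Sum>a\<in>H. \<Sum>b\<in>H. cnj (c a) * (c b * cinner a (\<rho> b)))"
      by (simp only: y_def clinear_sum[OF lin] clinear_scaleC[OF lin] cinner_sum_left
          cinner_scaleC_left)
        (simp add: cinner_sum_right cinner_scaleC_right sum_distrib_left)
    then have "cmod (cinner y (\<rho> y)) \<le> (\<Sum>a\<in>H. \<Sum>b\<in>H. cmod (cnj (c a) * (c b * cinner a (\<rho> b))))"
      by (simp only:) (intro order_trans[OF norm_sum] sum_mono norm_sum)
    also have "\<dots> \<le> (\<Sum>a\<in>H. \<Sum>b\<in>H. (cmod (c a) * sqrt (f a)) * (cmod (c b) * sqrt (f b)))"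
    proof (intro sum_mono)
      fix a b
      show "cmod (cnj (c a) * (c b * cinner a (\<rho> b))) \<le> (cmod (c a) * sqrt (f a)) * (cmod (c b) * sqrt (f b))"
        using mult_left_mono[OF offdiag[of a b], of "cmod (c a) * cmod (c b)"]
        by (simp add: norm_mult mult_ac)
    qed
    also have "\<dots> = (\<Sum>a\<in>H. cmod (c a) * sqrt (f a))\<^sup>2"
      by (simp add: power2_eq_square sum_product)
    also have "\<dots> \<le> (\<Sum>a\<in>H. (cmod (c a))\<^sup>2) * (\<Sum>a\<in>H. (sqrt (f a))\<^sup>2)"
      by (rule Cauchy_Schwarz_ineq_sum)
    also have "\<dots> \<le> (norm x)\<^sup>2 * \<epsilon>"
    proof (rule mult_mono)
      show "(\<Sum>a\<in>H. (cmod (c a))\<^sup>2) \<le> (norm x)\<^sup>2"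
        unfolding nx using H G by (intro sum_mono2) auto
      show "(\<Sum>a\<in>H. (sqrt (f a))\<^sup>2) \<le> \<epsilon>"
        using tail[OF H(1,2)] by (simp add: f0)
    qed (auto intro: sum_nonneg simp: f0)
    finally have "Re (cinner y (\<rho> y)) \<le> (norm x)\<^sup>2 * \<epsilon>"
      using complex_Re_le_cmod order_trans by blast
    then have "K * Re (cinner y (\<rho> y)) \<le> K * ((norm x)\<^sup>2 * \<epsilon>)"
      using K(1) by simp
    also have "\<dots> = e\<^sup>2 * (norm x)\<^sup>2" using K(1) by (simp add: \<epsilon>_def)
    finally show ?thesis using small[of y] Sy by simp
  qed
  have "closed {x. (norm (S x - \<rho> x))\<^sup>2 \<le> e\<^sup>2 * (norm x)\<^sup>2}"
    unfolding S_def
    by (intro closed_Collect_le continuous_intros linear_continuous_on[OF bl]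
        linear_continuous_on[OF bounded_linear_compose[OF bounded_linear_scaleC_left bounded_linear_cinner_right]])
  then have "closure (cspan B) \<subseteq> {x. (norm (S x - \<rho> x))\<^sup>2 \<le> e\<^sup>2 * (norm x)\<^sup>2}"
    using span_bound by (intro closure_minimal) auto
  then have bound: "(norm (S x - \<rho> x))\<^sup>2 \<le> e\<^sup>2 * (norm x)\<^sup>2" for x
    using B by (auto simp: orthonormal_basis_def)
  have "norm (S x - \<rho> x) \<le> e" if "norm x \<le> 1" for x
  proof -
    have "e\<^sup>2 * (norm x)\<^sup>2 \<le> e\<^sup>2" using that by (simp add: mult_left_le power_le_one)
    then have "(norm (S x - \<rho> x))\<^sup>2 \<le> e\<^sup>2" using bound[of x] by linarith
    then show ?thesis using \<open>e > 0\<close> by (simp add: power2_le_iff_abs_le)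
  qed
  then show "\<exists>S. compact_operator S \<and> (\<forall>x. norm x \<le> 1 \<longrightarrow> norm (S x - \<rho> x) \<le> e)"
    using compS by blast
qed


subsection \<open>Kraus decomposition and tensor products\<close>

text \<open>The operator \<open>A \<otimes> 1\<close> on the tensor product. With
  \<open>complex\<close> as second factor it is \<open>A\<close> acting on column vectors, which
  lets facts about positive operators apply to matrices.\<close>

definition lift_op :: "complex ^ 'd ^ 'd \<Rightarrow> 'b::chilbert_space ^ 'd \<Rightarrow> 'b ^ 'd"
  where "lift_op A = tensor_op A (\<lambda>b. b)"

definition adjoint_mat :: "complex ^ 'd ^ 'd \<Rightarrow> complex ^ 'd ^ 'd"
  where "adjoint_mat A = (\<chi> i j. cnj (A $ j $ i))"

lemma scaleC_nth: "(c *\<^sub>C x) $ i = c *\<^sub>C (x $ i)"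
  by (simp add: scaleC_vec_def)

lemma lift_op_nth: "lift_op A x $ k = (\<Sum>l\<in>UNIV. (A $ k $ l) *\<^sub>C (x $ l))"
  by (simp add: lift_op_def tensor_op_def)

lemma bounded_clinear_lift_op: "bounded_clinear (lift_op A)"
  unfolding bounded_clinear_def
proof
  have add: "lift_op A (x + y) = lift_op A x + lift_op A y" for x y :: "'a ^ 'b"
    by (simp add: vec_eq_iff lift_op_nth scaleC_add_right sum.distrib)
  have scale: "lift_op A (c *\<^sub>C x) = c *\<^sub>C lift_op A x" for c and x :: "'a ^ 'b"
    by (simp add: vec_eq_iff lift_op_nth scaleC_nth chilbert.scale_sum_right scaleC_scaleC mult.commute)
  show "clinear (lift_op A :: 'a ^ 'b \<Rightarrow> 'a ^ 'b)"
    by (rule clinearI) (rule add, rule scale)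
  show "bounded_linear (lift_op A :: 'a ^ 'b \<Rightarrow> 'a ^ 'b)"
  proof (rule bounded_linear_intro[where K = "\<Sum>k\<in>UNIV. \<Sum>l\<in>UNIV. cmod (A $ k $ l)"])
    show "lift_op A (r *\<^sub>R x) = r *\<^sub>R lift_op A x" for r and x :: "'a ^ 'b"
      by (metis scale scaleC_of_real)
    fix x :: "'a ^ 'b"
    have "norm (lift_op A x) \<le> (\<Sum>k\<in>UNIV. norm (lift_op A x $ k))"
      unfolding norm_vec_def by (rule L2_set_le_sum) simp
    also have "\<dots> \<le> (\<Sum>k\<in>UNIV. \<Sum>l\<in>UNIV. norm ((A $ k $ l) *\<^sub>C (x $ l)))"
      unfolding lift_op_nth by (intro sum_mono norm_sum)
    also have "\<dots> \<le> (\<Sum>k\<in>UNIV. \<Sum>l\<in>UNIV. cmod (A $ k $ l) * norm x)"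
      unfolding norm_scaleC by (intro sum_mono mult_left_mono Finite_Cartesian_Product.norm_nth_le) simp
    finally show "norm (lift_op A x) \<le> norm x * (\<Sum>k\<in>UNIV. \<Sum>l\<in>UNIV. cmod (A $ k $ l))"
      by (simp add: sum_distrib_left mult.commute)
  qed (rule add)
qed

lemmas clinear_lift_op = bounded_clinear_lift_op[unfolded bounded_clinear_def, THEN conjunct1]
  and bounded_linear_lift_op = bounded_clinear_lift_op[unfolded bounded_clinear_def, THEN conjunct2]

lemma cinner_lift_op_left: "cinner (lift_op A x) y = cinner x (lift_op (adjoint_mat A) y)"
proof -
  have "cinner (lift_op A x) y = (\<Sum>k\<in>UNIV. \<Sum>l\<in>UNIV. cnj (A $ k $ l) * cinner (x $ l) (y $ k))"
    by (simp add: cinner_vec_def lift_op_nth cinner_sum_left cinner_scaleC_left)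
  also have "\<dots> = (\<Sum>l\<in>UNIV. \<Sum>k\<in>UNIV. cnj (A $ k $ l) * cinner (x $ l) (y $ k))"
    by (rule sum.swap)
  also have "\<dots> = cinner x (lift_op (adjoint_mat A) y)"
    by (simp add: cinner_vec_def lift_op_nth cinner_sum_right cinner_scaleC_right adjoint_mat_def)
  finally show ?thesis .
qed

lemma adjoint_mat_adjoint_mat [simp]: "adjoint_mat (adjoint_mat A) = A"
  by (simp add: adjoint_mat_def vec_eq_iff)

lemma cinner_lift_op_right: "cinner x (lift_op A y) = cinner (lift_op (adjoint_mat A) x) y"
  by (simp add: cinner_lift_op_left)

section \<open>Positive matrices as sums of rank one matrices\<close>

lemma cinner_axis_left: "cinner (axis i 1) (v :: complex ^ 'n) = v $ i"
proof -
  have "cinner (axis i 1) v = (\<Sum>k\<in>UNIV. if k = i then v $ k else 0)"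
    unfolding cinner_vec_def by (rule sum.cong) (auto simp: axis_def cinner_complex_def)
  then show ?thesis by simp
qed

lemma lift_op_axis: "lift_op A (axis j 1) $ i = A $ i $ j" for A :: "complex ^ 'n ^ 'n"
proof -
  have "lift_op A (axis j (1::complex)) $ i = (\<Sum>l\<in>UNIV. if l = j then A $ i $ l else 0)"
    unfolding lift_op_nth by (rule sum.cong) (auto simp: axis_def scaleC_complex_def)
  then show ?thesis by simp
qed

text \<open>A Cholesky decomposition, by induction on a set \<open>S\<close> containing the indices
  of all nonzero rows; each step clears one row.\<close>

lemma positive_matrix_sum_rank_one:
  fixes C :: "complex ^ 'n ^ 'n"
  assumes "positive_operator (lift_op C :: complex ^ 'n \<Rightarrow> complex ^ 'n)"
    and "\<And>i j. i \<notin> S \<Longrightarrow> C $ i $ j = 0"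
  shows "\<exists>a. \<forall>i j. C $ i $ j = (\<Sum>m\<in>S. a m i * cnj (a m j))"
proof -
  have "finite S" by simp
  then show ?thesis using assms
  proof (induction S arbitrary: C)
    case empty
    then show ?case by simp
  next
    case (insert s S)
    let ?T = "lift_op C :: complex ^ 'n \<Rightarrow> complex ^ 'n"
    have pos: "positive_operator ?T" by fact
    have entry: "cinner (axis i 1) (?T (axis j 1)) = C $ i $ j" for i j
      by (simp add: cinner_axis_left lift_op_axis)
    have herm: "C $ j $ i = cnj (C $ i $ j)" for i j
      using positive_operator_selfadjoint[OF pos, of "axis i 1" "axis j 1"] entry[of i j] entry[of j i]
      by (metis cinner_commute)
    have ge0: "C $ s $ s \<in> \<real>\<^sub>\<ge>\<^sub>0"
      using pos entry[of s s] by (metis positive_operator_def)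
    define c where "c = Re (C $ s $ s)"
    have c: "C $ s $ s = complex_of_real c" "c \<ge> 0"
      using ge0 by (auto simp: c_def complex_nonneg_Reals_iff complex_eq_iff)
    have CS: "(cmod (cinner v (?T (axis s 1))))\<^sup>2 \<le> Re (cinner v (?T v)) * c" for v
      using positive_operator_Cauchy_Schwarz[OF pos, of v "axis s 1"]
      by (simp add: entry c(1))
    show ?case
    proof (cases "c = 0")
      case True
      have "C $ j $ s = 0" for j
        using CS[of "axis j 1"] True by (simp add: entry)
      then have "C $ s $ j = 0" for j using herm[of j s] by simp
      then have "\<And>i j. i \<notin> S \<Longrightarrow> C $ i $ j = 0" using insert.prems(2) by (metis insertE)
      from insert.IH[OF pos this] obtain a
        where a: "\<And>i j. C $ i $ j = (\<Sum>m\<in>S. a m i * cnj (a m j))" by blast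
      \<comment> \<open>The induction hypothesis says nothing about \<open>a s\<close>, so it is
        reset to zero.\<close>
      have "C $ i $ j = (\<Sum>m\<in>insert s S. (a(s := \<lambda>_. 0)) m i * cnj ((a(s := \<lambda>_. 0)) m j))" for i j
      proof -
        have "(\<Sum>m\<in>S. (a(s := \<lambda>_. 0)) m i * cnj ((a(s := \<lambda>_. 0)) m j)) = C $ i $ j"
          unfolding a using insert.hyps by (intro sum.cong) auto
        then show ?thesis using insert.hyps by simp
      qed
      then show ?thesis by blast
    next
      case False
      then have "c > 0" using c(2) by simp
      \<comment> \<open>Column \<open>s\<close> scaled so that the rank one matrix built from
        \<open>u\<close> agrees with \<open>C\<close> on row and column \<open>s\<close>.\<close>
      define u :: "complex ^ 'n" where "u = (\<chi> i. C $ i $ s / complex_of_real (sqrt c))"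
      \<comment> \<open>subtracting the rank one part leaves the Schur complement, which is again positive\<close>
      define D :: "complex ^ 'n ^ 'n" where "D = (\<chi> i j. C $ i $ j - u $ i * cnj (u $ j))"
      have uu: "u $ i * cnj (u $ j) = C $ i $ s * C $ s $ j / complex_of_real c" for i j
      proof -
        have "complex_of_real (sqrt c) * complex_of_real (sqrt c) = complex_of_real c"
          using c(2) by (simp add: of_real_mult[symmetric] del: of_real_mult)
        then show ?thesis using herm[of s j] by (simp add: u_def)
      qed
      have Ts: "?T (axis s 1) = complex_of_real (sqrt c) *\<^sub>C u"
        using \<open>c > 0\<close> by (simp add: vec_eq_iff lift_op_axis u_def scaleC_nth scaleC_complex_def)
      have form: "cinner v (lift_op D v) = cinner v (?T v) - complex_of_real ((cmod (cinner v u))\<^sup>2)"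
        for v :: "complex ^ 'n"
      proof -
        have "lift_op D v = ?T v - cinner u v *\<^sub>C u"
          by (simp add: vec_eq_iff lift_op_nth D_def scaleC_complex_def scaleC_nth cinner_vec_def
              cinner_complex_def algebra_simps sum_subtractf sum_distrib_left)
        then have "cinner v (lift_op D v) = cinner v (?T v) - cinner u v * cinner v u"
          by (simp add: cinner_diff_right cinner_scaleC_right)
        also have "cinner u v = cnj (cinner v u)" by (rule cinner_commute)
        finally show ?thesis by (simp add: complex_norm_square mult.commute del: of_real_power)
      qed
      have "cinner v (lift_op D v) \<in> \<real>\<^sub>\<ge>\<^sub>0" for v :: "complex ^ 'n"
      proof -
        \<comment> \<open>\<open>CS\<close> divided by \<open>c\<close> is exactly the positivity of
          the form of \<open>D\<close>.\<close>
        have "(cmod (cinner v (?T (axis s 1))))\<^sup>2 = c * (cmod (cinner v u))\<^sup>2"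
          using c(2) by (simp add: Ts cinner_scaleC_right norm_mult power_mult_distrib)
        then have "c * (cmod (cinner v u))\<^sup>2 \<le> c * Re (cinner v (?T v))"
          using CS[of v] by (simp add: mult.commute)
        then have "(cmod (cinner v u))\<^sup>2 \<le> Re (cinner v (?T v))"
          using \<open>c > 0\<close> by simp
        moreover have "Im (cinner v (?T v)) = 0"
          using pos by (simp add: positive_operator_def complex_nonneg_Reals_iff)
        ultimately show ?thesis by (simp add: form complex_nonneg_Reals_iff del: of_real_power)
      qed
      then have "positive_operator (lift_op D :: complex ^ 'n \<Rightarrow> complex ^ 'n)"
        by (simp add: positive_operator_def bounded_clinear_lift_op)
      moreover have "D $ i $ j = 0" if "i \<notin> S" for i j
      proof (cases "i = s")
        case True
        then show ?thesis using \<open>c > 0\<close> by (simp add: D_def uu c(1))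
      next
        case False
        then show ?thesis using that insert.prems(2) by (simp add: D_def uu)
      qed
      ultimately obtain a where a: "\<And>i j. D $ i $ j = (\<Sum>m\<in>S. a m i * cnj (a m j))"
        using insert.IH[of D] by blast
      let ?b = "a(s := \<lambda>i. u $ i)"
      have "C $ i $ j = (\<Sum>m\<in>insert s S. ?b m i * cnj (?b m j))" for i j
      proof -
        have "(\<Sum>m\<in>S. ?b m i * cnj (?b m j)) = D $ i $ j"
          unfolding a using insert.hyps by (intro sum.cong) auto
        then show ?thesis using insert.hyps by (simp add: D_def)
      qed
      then show ?thesis by blast
    qed
  qed
qed

section \<open>Choi matrix and Kraus form\<close>

lemma sum_UNIV_prod: "(\<Sum>p\<in>UNIV. f p) = (\<Sum>i\<in>UNIV. \<Sum>j\<in>UNIV. f (i, j))"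
  by (simp add: sum.cartesian_product case_prod_unfold flip: UNIV_Times_UNIV)

text \<open>Choi's argument: the block matrix of all matrix units is positive, so complete
  positivity with a \<open>d\<close>-dimensional ancilla makes the Choi matrix positive. The vectors
  of its rank one decomposition, reshaped into matrices, are the Kraus operators.\<close>

lemma completely_positive_Kraus:
  fixes E :: "complex ^ 'd ^ 'd \<Rightarrow> complex ^ 'd ^ 'd"
  assumes "completely_positive E"
  obtains K :: "'d \<times> 'd \<Rightarrow> complex ^ 'd ^ 'd"
  where "\<And>i j k l. E (matrix_unit i j) $ k $ l = (\<Sum>m\<in>UNIV. K m $ k $ i * cnj (K m $ l $ j))"
proof -
  \<comment> \<open>the Choi matrix of \<open>E\<close>\<close>
  define C :: "complex ^ ('d \<times> 'd) ^ ('d \<times> 'd)"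
    where "C = (\<chi> p q. E (matrix_unit (snd p) (snd q)) $ fst p $ fst q)"
  \<comment> \<open>Ancilla indices are natural numbers, so the index type is enumerated.\<close>
  obtain g :: "nat \<Rightarrow> 'd" where g: "bij_betw g {0..<CARD('d)} UNIV"
    using ex_bij_betw_nat_finite[of "UNIV :: 'd set"] by auto
  have g': "bij_betw g {..<CARD('d)} UNIV" using g by (simp add: atLeast0LessThan)
  have "positive_block_matrix CARD('d) (\<lambda>i j. matrix_unit (g i) (g j))"
    unfolding positive_block_matrix_def
  proof
    fix v :: "nat \<Rightarrow> complex ^ 'd"
    have mu: "cinner x (matrix_unit i j *v y) = cnj (x $ i) * y $ j" for x y :: "complex ^ 'd" and i j
    proof -
      have "(matrix_unit i j *v y) $ k = (if k = i then y $ j else 0)" for k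
      proof -
        have "(matrix_unit i j *v y) $ k = (\<Sum>l\<in>UNIV. if l = j then if k = i then y $ l else 0 else 0)"
          unfolding matrix_vector_mult_def vec_lambda_beta
          by (rule sum.cong) (auto simp: matrix_unit_def)
        then show ?thesis by simp
      qed
      then have "cinner x (matrix_unit i j *v y) = (\<Sum>k\<in>UNIV. if k = i then cnj (x $ k) * y $ j else 0)"
        unfolding cinner_vec_def by (intro sum.cong) (auto simp: cinner_complex_def)
      then show ?thesis by simp
    qed
    \<comment> \<open>The block matrix has rank one: its form is the squared modulus of the linear
      functional \<open>w\<close>.\<close>
    define w where "w = (\<Sum>i<CARD('d). v i $ g i)"
    have "(\<Sum>i<CARD('d). \<Sum>j<CARD('d). cinner (v i) (matrix_unit (g i) (g j) *v v j)) = cnj w * w"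
      by (simp add: mu w_def sum_product)
    also have "\<dots> = complex_of_real ((cmod w)\<^sup>2)"
      by (simp add: complex_norm_square mult.commute del: of_real_power)
    finally show "(\<Sum>i<CARD('d). \<Sum>j<CARD('d). cinner (v i) (matrix_unit (g i) (g j) *v v j)) \<in> \<real>\<^sub>\<ge>\<^sub>0"
      by (simp del: of_real_power)
  qed
  then have blk: "positive_block_matrix CARD('d) (\<lambda>i j. E (matrix_unit (g i) (g j)))"
    using assms unfolding completely_positive_def by blast
  have "cinner v (lift_op C v) \<in> \<real>\<^sub>\<ge>\<^sub>0" for v :: "complex ^ ('d \<times> 'd)"
  proof -
    \<comment> \<open>Cuts a vector of the doubled space into one block per ancilla index, the
      second component of the pair.\<close>
    define V :: "'d \<Rightarrow> complex ^ 'd" where "V i = (\<chi> k. v $ (k, i))" for i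
    have "(\<Sum>i<CARD('d). \<Sum>j<CARD('d). cinner (V (g i)) (E (matrix_unit (g i) (g j)) *v V (g j))) \<in> \<real>\<^sub>\<ge>\<^sub>0"
      using blk unfolding positive_block_matrix_def by (rule spec[where x = "\<lambda>i. V (g i)"])
    also have "(\<Sum>i<CARD('d). \<Sum>j<CARD('d). cinner (V (g i)) (E (matrix_unit (g i) (g j)) *v V (g j)))
        = (\<Sum>i\<in>UNIV. \<Sum>j\<in>UNIV. cinner (V i) (E (matrix_unit i j) *v V j))"
      by (subst sum.reindex_bij_betw[OF g', symmetric], rule sum.cong[OF refl],
          subst sum.reindex_bij_betw[OF g', symmetric]) simp
    also have "\<dots> = (\<Sum>i\<in>UNIV. \<Sum>j\<in>UNIV. \<Sum>k\<in>UNIV. \<Sum>l\<in>UNIV.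
        cnj (v $ (k, i)) * (E (matrix_unit i j) $ k $ l * v $ (l, j)))"
      by (simp add: cinner_vec_def cinner_complex_def matrix_vector_mult_def V_def sum_distrib_left)
    \<comment> \<open>The sums are reordered to match the pairs \<open>(k, i)\<close> and
      \<open>(l, j)\<close> that index the Choi matrix.\<close>
    also have "\<dots> = (\<Sum>i\<in>UNIV. \<Sum>k\<in>UNIV. \<Sum>j\<in>UNIV. \<Sum>l\<in>UNIV.
        cnj (v $ (k, i)) * (E (matrix_unit i j) $ k $ l * v $ (l, j)))"
      by (rule sum.cong[OF refl], rule sum.swap)
    also have "\<dots> = (\<Sum>k\<in>UNIV. \<Sum>i\<in>UNIV. \<Sum>l\<in>UNIV. \<Sum>j\<in>UNIV.
        cnj (v $ (k, i)) * (E (matrix_unit i j) $ k $ l * v $ (l, j)))"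
      by (subst sum.swap, rule sum.cong[OF refl], rule sum.cong[OF refl], rule sum.swap)
    also have "\<dots> = cinner v (lift_op C v)"
      by (simp add: cinner_vec_def cinner_complex_def lift_op_nth scaleC_complex_def C_def
          sum_distrib_left sum_UNIV_prod)
    finally show ?thesis .
  qed
  then have "positive_operator (lift_op C :: complex ^ ('d \<times> 'd) \<Rightarrow> complex ^ ('d \<times> 'd))"
    by (simp add: positive_operator_def bounded_clinear_lift_op)
  then have "\<exists>a. \<forall>p q. C $ p $ q = (\<Sum>m\<in>(UNIV :: ('d \<times> 'd) set). a m p * cnj (a m q))"
    by (rule positive_matrix_sum_rank_one) simp
  then obtain a where a: "\<And>p q. C $ p $ q = (\<Sum>m\<in>(UNIV :: ('d \<times> 'd) set). a m p * cnj (a m q))" by blast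
  show ?thesis
  proof
    fix i j k l
    show "E (matrix_unit i j) $ k $ l
        = (\<Sum>m\<in>UNIV. (\<chi> k i. a m (k, i)) $ k $ i * cnj ((\<chi> k i. a m (k, i)) $ l $ j))"
      using a[of "(k, i)" "(l, j)"] by (simp add: C_def)
  qed
qed

text \<open>\<open>tensor_id\<close> sees \<open>E\<close> only through its values on matrix units,
  so a Kraus form there carries over with each \<open>K m\<close> replaced by
  \<open>K m \<otimes> 1\<close>.\<close>

lemma tensor_id_Kraus:
  fixes K :: "'m::finite \<Rightarrow> complex ^ 'd ^ 'd"
  assumes "clinear T"
    and K: "\<And>i j k l. E (matrix_unit i j) $ k $ l = (\<Sum>m\<in>UNIV. K m $ k $ i * cnj (K m $ l $ j))"
  shows "tensor_id E T x = (\<Sum>m\<in>UNIV. lift_op (K m) (T (lift_op (adjoint_mat (K m)) x)))"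
proof -
  have axis_expand: "y = (\<Sum>j\<in>UNIV. axis j (y $ j))" for y :: "'a ^ 'd"
    by (subst vec_eq_iff) (simp add: axis_def)
  have axis_sum: "axis j (\<Sum>l\<in>UNIV. f l) = (\<Sum>l\<in>UNIV. axis j (f l))" for j :: 'd and f :: "'d \<Rightarrow> 'a"
    by (simp add: vec_eq_iff axis_def)
  have axis_scale: "axis j (c *\<^sub>C b) = c *\<^sub>C axis j b" for j :: 'd and c and b :: 'a
    by (simp add: vec_eq_iff axis_def scaleC_nth)
  have T: "T y $ i = (\<Sum>j\<in>UNIV. T (axis j (y $ j)) $ i)" for y i
    by (subst (1) axis_expand) (simp add: clinear_sum[OF assms(1)])
  have TK: "T (lift_op (adjoint_mat (K m)) x) $ i
      = (\<Sum>j\<in>UNIV. \<Sum>l\<in>UNIV. cnj (K m $ l $ j) *\<^sub>C (T (axis j (x $ l)) $ i))" for m i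
    by (subst T) (simp add: lift_op_nth axis_sum axis_scale clinear_sum[OF assms(1)]
        clinear_scaleC[OF assms(1)] scaleC_nth adjoint_mat_def)
  have "tensor_id E T x $ k
      = (\<Sum>m\<in>UNIV. lift_op (K m) (T (lift_op (adjoint_mat (K m)) x))) $ k" for k
  proof -
    let ?t = "\<lambda>m i j l. (K m $ k $ i * cnj (K m $ l $ j)) *\<^sub>C (T (axis j (x $ l)) $ i)"
    have "tensor_id E T x $ k = (\<Sum>i\<in>UNIV. \<Sum>j\<in>UNIV. \<Sum>l\<in>UNIV. \<Sum>m\<in>UNIV. ?t m i j l)"
      by (simp add: tensor_id_def tensor_op_def block_def K chilbert.scale_sum_left)
    also have "\<dots> = (\<Sum>i\<in>UNIV. \<Sum>j\<in>UNIV. \<Sum>m\<in>UNIV. \<Sum>l\<in>UNIV. ?t m i j l)"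
      by (intro sum.cong[OF refl] sum.swap)
    also have "\<dots> = (\<Sum>i\<in>UNIV. \<Sum>m\<in>UNIV. \<Sum>j\<in>UNIV. \<Sum>l\<in>UNIV. ?t m i j l)"
      by (intro sum.cong[OF refl] sum.swap)
    also have "\<dots> = (\<Sum>m\<in>UNIV. \<Sum>i\<in>UNIV. \<Sum>j\<in>UNIV. \<Sum>l\<in>UNIV. ?t m i j l)"
      by (rule sum.swap)
    also have "\<dots> = (\<Sum>m\<in>UNIV. lift_op (K m) (T (lift_op (adjoint_mat (K m)) x))) $ k"
      by (simp add: lift_op_nth[of "K _"] TK chilbert.scale_sum_right scaleC_scaleC)
    finally show ?thesis .
  qed
  then show ?thesis by (simp add: vec_eq_iff)
qed

section \<open>Compatibility of \<open>tensor_id\<close> with sums, composition and identity\<close>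

lemma tensor_id_sum: "tensor_id E (\<lambda>x. \<Sum>s\<in>I. T s x) x = (\<Sum>s\<in>I. tensor_id E (T s) x)"
proof -
  have "tensor_op A (block (\<lambda>x. \<Sum>s\<in>I. T s x) i j) x = (\<Sum>s\<in>I. tensor_op A (block (T s) i j) x)" for A i j
    unfolding vec_eq_iff tensor_op_def block_def
    by (simp add: chilbert.scale_sum_right) (intro allI sum.swap)
  then have "tensor_id E (\<lambda>x. \<Sum>s\<in>I. T s x) x
      = (\<Sum>i\<in>UNIV. \<Sum>j\<in>UNIV. \<Sum>s\<in>I. tensor_op (E (matrix_unit i j)) (block (T s) i j) x)"
    by (simp add: tensor_id_def)
  also have "\<dots> = (\<Sum>i\<in>UNIV. \<Sum>s\<in>I. \<Sum>j\<in>UNIV. tensor_op (E (matrix_unit i j)) (block (T s) i j) x)"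
    by (intro sum.cong[OF refl] sum.swap)
  also have "\<dots> = (\<Sum>s\<in>I. tensor_id E (T s) x)"
    unfolding tensor_id_def by (rule sum.swap)
  finally show ?thesis .
qed

lemma clinear_block:
  assumes "clinear T"
  shows "clinear (block T i j)"
proof (rule clinearI)
  have "axis j (x + y) = axis j x + axis j y" for x y :: 'a
    by (simp add: vec_eq_iff axis_def)
  then show "block T i j (x + y) = block T i j x + block T i j y" for x y
    by (simp add: block_def clinear_add[OF assms])
  have "axis j (c *\<^sub>C x) = c *\<^sub>C axis j x" for c and x :: 'a
    by (simp add: vec_eq_iff axis_def scaleC_nth)
  then show "block T i j (c *\<^sub>C x) = c *\<^sub>C block T i j x" for c x
    by (simp add: block_def clinear_scaleC[OF assms] scaleC_nth)
qed

text \<open>The inner \<open>tensor_id\<close> is by definition a sum of elementary tensors, and on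
  those the outer one acts on the first factor alone. This makes the orbit computable one step at a
  time.\<close>

lemma tensor_id_compose:
  assumes "clinear E" and "clinear T"
  shows "tensor_id (E \<circ> F) T = tensor_id E (tensor_id F T)"
proof
  fix x
  have "tensor_id E (tensor_id F T) x
      = (\<Sum>i\<in>UNIV. \<Sum>j\<in>UNIV. tensor_id E (tensor_op (F (matrix_unit i j)) (block T i j)) x)"
    unfolding tensor_id_def[of F T, abs_def] tensor_id_sum ..
  also have "\<dots> = tensor_id (E \<circ> F) T x"
    by (simp add: tensor_id_tensor_op[OF assms(1) clinear_block[OF assms(2)]] tensor_id_def)
  finally show "tensor_id (E \<circ> F) T x = tensor_id E (tensor_id F T) x" ..
qed

lemma tensor_id_id:
  assumes "clinear T"
  shows "tensor_id id T = T"
  using sum_tensor_op_block[OF assms] by (simp add: tensor_id_def fun_eq_iff)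


subsection \<open>Spans of products of matrices\<close>

text \<open>New letters are multiplied on the right, so that \<open>lift_op\<close> of a longer word
  applies the new letter to the vector first, as the recursion for the quadratic forms
  requires.\<close>

fun word_products :: "('m \<Rightarrow> complex ^ 'd ^ 'd) \<Rightarrow> nat \<Rightarrow> (complex ^ 'd ^ 'd) set"
  where
    "word_products L 0 = {mat 1}"
  | "word_products L (Suc n) = {A ** L m |A m. A \<in> word_products L n}"

text \<open>Strictly fewer than \<open>n\<close> factors: \<open>n = 0\<close> gives the zero space,
  \<open>n = 1\<close> the scalar matrices, \<open>n = 2\<close> the span of the identity and the
  letters.\<close>

definition short_words_span :: "('m \<Rightarrow> complex ^ 'd ^ 'd) \<Rightarrow> nat \<Rightarrow> (complex ^ 'd ^ 'd) set"
  where "short_words_span L n = cspan (\<Union>k<n. word_products L k)"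

lemma matrix_mult_add_left: "(A + B) ** C = A ** C + B ** C" for A B C :: "complex ^ 'd ^ 'd"
  by (simp add: matrix_matrix_mult_def vec_eq_iff distrib_right sum.distrib)

lemma matrix_mult_scaleC_right: "A ** (c *\<^sub>C B) = c *\<^sub>C (A ** B)" for A B :: "complex ^ 'd ^ 'd"
  by (simp add: matrix_matrix_mult_def vec_eq_iff scaleC_nth scaleC_complex_def sum_distrib_left mult_ac)

lemma matrix_mult_scaleC_left: "(c *\<^sub>C A) ** B = c *\<^sub>C (A ** B)" for A B :: "complex ^ 'd ^ 'd"
  by (simp add: matrix_matrix_mult_def vec_eq_iff scaleC_nth scaleC_complex_def sum_distrib_left mult_ac)

lemma finite_dimensional_matrices:
  obtains B :: "(complex ^ 'd ^ 'd) set"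
  where "finite_dimensional_vector_space (scaleC :: complex \<Rightarrow> complex ^ 'd ^ 'd \<Rightarrow> _) B"
    and "card B \<le> CARD('d)\<^sup>2"
proof -
  let ?M = "range (\<lambda>(i::'d, j). matrix_unit i j)"
  obtain B where B: "B \<subseteq> ?M" "chilbert.independent B" "?M \<subseteq> cspan B"
    using chilbert.maximal_independent_subset by blast
  have "A \<in> cspan ?M" for A :: "complex ^ 'd ^ 'd"
    by (subst sum_matrix_unit[symmetric], (rule chilbert.span_sum)+, rule chilbert.span_scale,
        rule chilbert.span_base) auto
  then have "cspan B = UNIV"
    using chilbert.span_minimal[OF B(3) chilbert.subspace_span] by auto
  then have "finite_dimensional_vector_space (scaleC :: complex \<Rightarrow> complex ^ 'd ^ 'd \<Rightarrow> _) B"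
    using B finite_subset[OF B(1)] by unfold_locales (auto simp: cspan_def)
  moreover have "card B \<le> CARD('d)\<^sup>2"
  proof -
    have "card B \<le> card ?M" using B(1) by (intro card_mono) auto
    also have "\<dots> \<le> card (UNIV :: ('d \<times> 'd) set)" by (rule card_image_le) simp
    finally show ?thesis by (simp add: power2_eq_square)
  qed
  ultimately show ?thesis using that by blast
qed

text \<open>Once the chain is stationary at \<open>n\<close>, the span is closed under right
  multiplication by letters, and it contains the identity.\<close>

lemma word_products_stable:
  assumes "short_words_span L (Suc n) \<subseteq> short_words_span L n"
  shows "word_products L k \<subseteq> short_words_span L n"
proof (induction k)
  case 0
  have "word_products L 0 \<subseteq> short_words_span L (Suc n)"
    unfolding short_words_span_def by (intro order_trans[OF _ chilbert.span_superset]) blast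
  then show ?case using assms by blast
next
  case (Suc k)
  have "A ** L m \<in> short_words_span L n" if "A \<in> short_words_span L n" for m A
  proof -
    have "A ** L m \<in> short_words_span L (Suc n)"
      using that unfolding short_words_span_def[of L n]
    proof (rule chilbert.span_induct)
      show "chilbert.subspace {A. A ** L m \<in> short_words_span L (Suc n)}"
        unfolding short_words_span_def
        by (auto simp: chilbert.subspace_def matrix_mult_add_left matrix_mult_scaleC_left
            chilbert.span_zero chilbert.span_add chilbert.span_scale)
      fix B assume "B \<in> (\<Union>k<n. word_products L k)"
      then obtain j where "j < n" "B \<in> word_products L j" by blast
      then have "B ** L m \<in> word_products L (Suc j)" "Suc j < Suc n" by auto
      then show "B ** L m \<in> short_words_span L (Suc n)"
        unfolding short_words_span_def by (intro chilbert.span_base) blast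
    qed
    then show ?thesis using assms by blast
  qed
  then show ?case using Suc by auto
qed

text \<open>Dimension counting alone gives stationarity at \<open>CARD('d)\<^sup>2\<close>. The last
  unit is gained because a chain that long could grow only by one dimension at each step, so its
  letters would commute.\<close>

lemma word_products_subset_short_words_span:
  fixes L :: "'m \<Rightarrow> complex ^ 'd ^ 'd"
  assumes d: "CARD('d) \<ge> 2"
  shows "word_products L k \<subseteq> short_words_span L (CARD('d)\<^sup>2 - 1)"
proof (rule ccontr)
  assume contra: "\<not> ?thesis"
  obtain B where
    "finite_dimensional_vector_space (scaleC :: complex \<Rightarrow> complex ^ 'd ^ 'd \<Rightarrow> _) B"
    and card_B: "card B \<le> CARD('d)\<^sup>2"
    by (rule finite_dimensional_matrices)
  then interpret fd: finite_dimensional_vector_space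
    "scaleC :: complex \<Rightarrow> complex ^ 'd ^ 'd \<Rightarrow> complex ^ 'd ^ 'd" B
    by simp
  define U where "U = short_words_span L"
  define N where "N = CARD('d)\<^sup>2"
  have "N \<ge> 2 * 2" unfolding N_def power2_eq_square using d by (intro mult_le_mono)
  then have N: "N \<ge> 4" by simp
  have sub: "chilbert.subspace (U n)" for n
    by (simp add: U_def short_words_span_def chilbert.subspace_span)
  have mono: "U n \<subseteq> U m" if "n \<le> m" for n m
    unfolding U_def short_words_span_def using that by (intro chilbert.span_mono) force
  \<comment> \<open>Stationarity at any \<open>n < N\<close> would put all words into
    \<open>U (N - 1)\<close>, against the assumption.\<close>
  have strict: "\<not> U (Suc n) \<subseteq> U n" if "n < N" for n
  proof -
    have "n \<le> N - 1" using that by simp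
    then show ?thesis
      using contra word_products_stable[of L n k] mono[of n "N - 1"] unfolding U_def N_def by blast
  qed
  have dim_less: "chilbert.dim (U n) < chilbert.dim (U (Suc n))" if "n < N" for n
  proof -
    have "U n \<subset> U (Suc n)" using strict[OF that] mono[of n "Suc n"] by auto
    moreover have "cspan (U m) = U m" for m
      using sub by (simp only: chilbert.span_eq_iff)
    ultimately show ?thesis
      using fd.dim_psubset[of "U n" "U (Suc n)", folded cspan_def] by (simp only:)
  qed
  have dim_UNIV: "chilbert.dim (UNIV :: (complex ^ 'd ^ 'd) set) \<le> N"
    using card_B by (simp add: N_def)
  have dim_le: "chilbert.dim (U n) \<le> N" for n
    using fd.dim_subset[of "U n" UNIV] dim_UNIV by simp
  \<comment> \<open>Counting starts at \<open>U 2\<close>: the \<open>N - 2\<close> strict steps up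
    to \<open>U N\<close> leave at most dimension 2 for it.\<close>
  have growth: "chilbert.dim (U 2) + n \<le> chilbert.dim (U (2 + n))" if "2 + n \<le> N" for n
    using that
  proof (induction n)
    case (Suc n)
    then have "2 + n < N" by simp
    from dim_less[OF this] Suc show ?case by simp
  qed simp
  have "2 + (N - 2) = N" using N by simp
  with growth[of "N - 2"] have growth_N: "chilbert.dim (U 2) + (N - 2) \<le> chilbert.dim (U N)"
    by simp
  then have "chilbert.dim (U 2) + (N - 2) \<le> N" using dim_le[of N] by linarith
  then have dim2: "chilbert.dim (U 2) \<le> 2" using N by simp
  have full: "U N = UNIV"
  proof -
    \<comment> \<open>\<open>U 0\<close>, \<open>U 1\<close>, \<open>U 2\<close> increase strictly,
      which gives the lower bound 2.\<close>
    have "chilbert.dim (U 2) \<ge> 2" using dim_less[of 0] dim_less[of 1] N by (simp add: numeral_2_eq_2)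
    then have "chilbert.dim (U N) \<ge> N" using growth_N N by simp
    then show ?thesis
      using fd.subspace_dim_equal[of "U N" UNIV] sub dim_UNIV by simp
  qed
  have one: "mat 1 \<in> U 2" and LU: "L m \<in> U 2" for m
  proof -
    have "mat 1 ** L m \<in> word_products L 1" unfolding One_nat_def word_products.simps by blast
    then show "L m \<in> U 2" unfolding U_def short_words_span_def
      by (intro chilbert.span_base) (auto simp: intro!: bexI[of _ 1])
    show "mat 1 \<in> U 2" unfolding U_def short_words_span_def
      by (intro chilbert.span_base) (auto intro!: bexI[of _ 0])
  qed
  have mat1: "(mat 1 :: complex ^ 'd ^ 'd) \<noteq> 0"
    by (auto simp: mat_def vec_eq_iff)
  \<comment> \<open>Besides the identity at most one generator is left; if \<open>U 2\<close> has
    only scalars, the identity itself serves as a dummy \<open>A\<close>.\<close>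
  obtain A where A: "U 2 \<subseteq> cspan {mat 1, A}"
  proof (cases "U 2 \<subseteq> cspan {mat 1}")
    case True
    then show ?thesis using that[of "mat 1"] by simp
  next
    case False
    then obtain A where A: "A \<in> U 2" "A \<notin> cspan {mat 1}" by blast
    have ind: "chilbert.independent {A, mat 1}"
      using A(2) mat1 by (intro chilbert.independent_insertI) (auto simp: chilbert.independent_insert chilbert.independent_empty)
    have "A \<noteq> mat 1" using A(2) by (auto intro: chilbert.span_base)
    then have "card {A, mat 1} = 2" by simp
    then have "U 2 \<subseteq> cspan {A, mat 1}"
      using ind A one dim2 by (intro fd.card_ge_dim_independent[folded cspan_def]) auto
    then show ?thesis using that[of A] by (simp add: insert_commute)
  qed
  define comm where "comm X Y \<longleftrightarrow> X ** Y = Y ** X" for X Y :: "complex ^ 'd ^ 'd"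
  have comm_sub: "chilbert.subspace {Y. comm X Y}" for X
    by (auto simp: chilbert.subspace_def comm_def matrix_add_ldistrib matrix_mult_add_left
        matrix_mult_scaleC_left matrix_mult_scaleC_right)
  have comm_sym: "comm X Y \<Longrightarrow> comm Y X" for X Y by (simp add: comm_def)
  have comm_span: "comm X Y" if "Y \<in> cspan S" "\<And>Z. Z \<in> S \<Longrightarrow> comm X Z" for X Y S
    using chilbert.span_minimal[of S "{Y. comm X Y}"] comm_sub that by blast
  have comm_mult: "comm X (Y ** Z)" if "comm X Y" "comm X Z" for X Y Z
    using that unfolding comm_def by (metis matrix_mul_assoc)
  have comm_one: "comm X (mat 1)" for X by (simp add: comm_def)
  have "comm X Y" if "X \<in> cspan {mat 1, A}" "Y \<in> cspan {mat 1, A}" for X Y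
  proof -
    have "comm A Y" by (rule comm_span[OF that(2)]) (auto simp: comm_one, simp add: comm_def)
    then have "comm Y X" by (intro comm_span[OF that(1)]) (auto simp: comm_one comm_sym)
    then show ?thesis by (rule comm_sym)
  qed
  then have commL: "comm (L m) (L n)" for m n using A LU by blast
  have comm_word: "comm X Y" if "\<And>m. comm X (L m)" "Y \<in> word_products L n" for X Y n
    using that(2)
  proof (induction n arbitrary: Y)
    case 0
    then show ?case by (simp add: comm_one)
  next
    case (Suc n)
    then show ?case using comm_mult that(1) by auto
  qed
  \<comment> \<open>Commutation spreads from letters to words and then to their span, which is
    everything: first in one argument, then in the other.\<close>
  have "comm X (L m)" for X m
  proof -
    have "X \<in> cspan (\<Union>k<N. word_products L k)"
      using full by (simp add: U_def short_words_span_def)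
    then have "comm (L m) X" by (rule comm_span) (auto intro: comm_word commL)
    then show ?thesis by (rule comm_sym)
  qed
  then have "comm X Y" for X Y
  proof -
    have "Y \<in> cspan (\<Union>k<N. word_products L k)"
      using full by (simp add: U_def short_words_span_def)
    then show ?thesis by (rule comm_span) (auto intro: comm_word \<open>\<And>X m. comm X (L m)\<close>)
  qed
  moreover obtain i j :: 'd where "i \<noteq> j"
    using d card_le_Suc0_iff_eq[of "UNIV :: 'd set"] by fastforce
  \<comment> \<open>The two products are the distinct diagonal units at \<open>i\<close> and at
    \<open>j\<close>; their \<open>(i, i)\<close> entries are 1 and 0.\<close>
  ultimately have "(matrix_unit i j ** matrix_unit j i) $ i $ i = (matrix_unit j i ** matrix_unit i j) $ i $ i"
    by (simp add: comm_def)
  then show False using \<open>i \<noteq> j\<close> by (simp add: matrix_matrix_mult_def matrix_unit_def if_distrib cong: if_cong)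
qed


subsection \<open>Supports along the orbit\<close>

lemma lift_op_mult: "lift_op (A ** B) x = lift_op A (lift_op B x)"
proof -
  have "(\<Sum>l\<in>UNIV. \<Sum>j\<in>UNIV. (A $ k $ j * B $ j $ l) *\<^sub>C (x $ l))
      = (\<Sum>j\<in>UNIV. \<Sum>l\<in>UNIV. (A $ k $ j * B $ j $ l) *\<^sub>C (x $ l))" for k
    by (rule sum.swap)
  then show ?thesis
    by (simp add: vec_eq_iff lift_op_nth matrix_matrix_mult_def chilbert.scale_sum_left
        chilbert.scale_sum_right scaleC_scaleC)
qed

lemma lift_op_mat_1: "lift_op (mat 1) x = x"
proof -
  have "lift_op (mat 1) x $ k = (\<Sum>l\<in>UNIV. if l = k then x $ l else 0)" for k
    unfolding lift_op_nth by (rule sum.cong) (auto simp: mat_def)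
  then show ?thesis by (simp add: vec_eq_iff)
qed

lemma subspace_lift_op_kernel:
  assumes "clinear T"
  shows "chilbert.subspace {A. T (lift_op A x) = 0}"
proof -
  have "lift_op (A + B) x = lift_op A x + lift_op B x" for A B
    by (simp add: vec_eq_iff lift_op_nth scaleC_add_left sum.distrib)
  moreover have "lift_op (c *\<^sub>C A) x = c *\<^sub>C lift_op A x" for c A
    by (simp add: vec_eq_iff lift_op_nth scaleC_nth scaleC_complex_def chilbert.scale_sum_right scaleC_scaleC)
  moreover have "lift_op 0 x = 0"
    by (simp add: vec_eq_iff lift_op_nth)
  ultimately show ?thesis
    by (simp add: chilbert.subspace_def clinear_add[OF assms] clinear_scaleC[OF assms] clinear_zero[OF assms])
qed

section \<open>Closure properties of positive operators\<close>

lemma positive_operator_sum: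
  assumes "\<And>i. i \<in> I \<Longrightarrow> positive_operator (T i)"
  shows "positive_operator (\<lambda>x. \<Sum>i\<in>I. T i x)"
proof -
  have lin: "clinear (T i)" "bounded_linear (T i)" "cinner x (T i x) \<in> \<real>\<^sub>\<ge>\<^sub>0" if "i \<in> I" for i x
    using assms[OF that] by (auto simp: positive_operator_def bounded_clinear_def)
  show ?thesis
    unfolding positive_operator_def bounded_clinear_def
  proof (intro conjI allI clinearI)
    show "bounded_linear (\<lambda>x. \<Sum>i\<in>I. T i x)" by (intro bounded_linear_sum lin)
    show "cinner x (\<Sum>i\<in>I. T i x) \<in> \<real>\<^sub>\<ge>\<^sub>0" for x
      unfolding cinner_sum_right by (auto simp: complex_nonneg_Reals_iff intro!: sum_nonneg sum.neutral
          dest: lin(3))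
  qed (simp_all add: clinear_add[OF lin(1)] clinear_scaleC[OF lin(1)] sum.distrib chilbert.scale_sum_right)
qed

lemma positive_operator_scaleR:
  assumes "positive_operator T" and "r \<ge> 0"
  shows "positive_operator (\<lambda>x. r *\<^sub>R T x)"
  using assms
  by (auto simp: positive_operator_def bounded_clinear_def cinner_scaleC_right scaleC_of_real[symmetric]
      complex_nonneg_Reals_iff clinear_add clinear_scaleC scaleC_add_right scaleC_scaleC mult.commute
      intro!: clinearI bounded_linear_compose[OF bounded_linear_scaleC_right])

lemma positive_operator_conjugate:
  assumes "positive_operator T"
  shows "positive_operator (\<lambda>x. lift_op A (T (lift_op (adjoint_mat A) x)))"
proof -
  have T: "clinear T" "bounded_linear T" "\<And>x. cinner x (T x) \<in> \<real>\<^sub>\<ge>\<^sub>0"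
    using assms by (auto simp: positive_operator_def bounded_clinear_def)
  show ?thesis
    unfolding positive_operator_def bounded_clinear_def
    by (auto intro!: clinearI bounded_linear_compose[OF bounded_linear_lift_op]
        bounded_linear_compose[OF T(2)] bounded_linear_lift_op
        simp: cinner_lift_op_right T clinear_add[OF T(1)] clinear_scaleC[OF T(1)]
        clinear_add[OF clinear_lift_op] clinear_scaleC[OF clinear_lift_op])
qed

lemma sum_nonneg_Reals_eq_0_iff:
  assumes "finite I" and "\<And>i. i \<in> I \<Longrightarrow> f i \<in> \<real>\<^sub>\<ge>\<^sub>0"
  shows "(\<Sum>i\<in>I. f i) = (0::complex) \<longleftrightarrow> (\<forall>i\<in>I. f i = 0)"
proof -
  have "Im (f i) = 0" "Re (f i) \<ge> 0" if "i \<in> I" for i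
    using assms(2)[OF that] by (auto simp: complex_nonneg_Reals_iff)
  then show ?thesis
    using assms(1) by (auto simp: complex_eq_iff sum_nonneg_eq_0_iff)
qed

text \<open>For \<open>CARD('d) = 1\<close> the average would run over no terms and be the zero
  operator, which satisfies every projection; hence the lower bound on the dimension.\<close>

theorem theorem8:
  fixes E :: "complex ^ 'd ^ 'd \<Rightarrow> complex ^ 'd ^ 'd"
    and \<rho> P :: "'b::chilbert_space ^ 'd \<Rightarrow> 'b ^ 'd"
    and t :: nat
  assumes "CARD('d) \<ge> 2"
    and "super_operator E" and "trace_preserving E" and "rational_entries E"
    and "density_operator \<rho>"
    and "is_projection P"
    and "t = CARD('d)\<^sup>2 - 1"
  shows "(\<forall>k. tensor_id (E ^^ k) \<rho> \<Turnstile> P) \<longleftrightarrow>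
    (\<lambda>x. (\<Sum>k<t. tensor_id (E ^^ k) \<rho> x) /\<^sub>R real t) \<Turnstile> P"
proof -
  have E: "clinear E" "completely_positive E" using assms(2) by (auto simp: super_operator_def)
  have \<rho>: "positive_operator \<rho>" "compact_operator \<rho>"
    using assms(5) by (auto simp: density_operator_compact density_operator_def)
  have lin: "clinear T" "bounded_linear T" "cinner x (T x) \<in> \<real>\<^sub>\<ge>\<^sub>0"
    if "positive_operator T" for T :: "'b ^ 'd \<Rightarrow> 'b ^ 'd" and x
    using that by (auto simp: positive_operator_def bounded_clinear_def)
  obtain K :: "'d \<times> 'd \<Rightarrow> complex ^ 'd ^ 'd"
    where K: "\<And>i j k l. E (matrix_unit i j) $ k $ l = (\<Sum>m\<in>UNIV. K m $ k $ i * cnj (K m $ l $ j))"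
    using completely_positive_Kraus[OF E(2)] by blast
  \<comment> \<open>Moving \<open>K m\<close> to the left of the inner product makes its adjoint act
    on \<open>x\<close>.\<close>
  define L where "L m = adjoint_mat (K m)" for m
  define \<sigma> where "\<sigma> k = tensor_id (E ^^ k) \<rho>" for k
  have \<sigma>_0: "\<sigma> 0 = \<rho>"
    unfolding \<sigma>_def funpow.simps(1) by (rule tensor_id_id[OF lin(1)[OF \<rho>(1)]])
  have "\<sigma> (Suc k) = tensor_id E (\<sigma> k)" for k
    unfolding \<sigma>_def funpow.simps(2) by (rule tensor_id_compose[OF E(1) lin(1)[OF \<rho>(1)]])
  \<comment> \<open>Linearity of \<open>\<sigma> k\<close> stays a premise; it is discharged in the
    induction that proves positivity.\<close>
  then have \<sigma>_Suc: "\<sigma> (Suc k) = (\<lambda>x. \<Sum>m\<in>UNIV. lift_op (K m) (\<sigma> k (lift_op (adjoint_mat (K m)) x)))"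
    if "clinear (\<sigma> k)" for k
    using tensor_id_Kraus[of "\<sigma> k" E K, OF that K] by auto
  have pos: "positive_operator (\<sigma> k)" for k
    by (induction k)
      (simp_all add: \<sigma>_0 \<rho> \<sigma>_Suc lin(1) positive_operator_sum positive_operator_conjugate)
  have comp: "compact_operator (\<sigma> k)" for k
  proof (induction k)
    case (Suc k)
    show ?case
      unfolding \<sigma>_Suc[OF lin(1)[OF pos]]
      by (rule compact_operator_sum, rule compact_operator_compose_left[OF
            compact_operator_compose_right[OF Suc lin(2)[OF pos] bounded_linear_lift_op]
            bounded_linear_lift_op])
  qed (simp add: \<sigma>_0 \<rho>)
  \<comment> \<open>The form at step \<open>Suc k\<close> is a sum of nonnegative forms at the
    vectors \<open>lift_op (L m) x\<close>, so the induction must range over all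
    \<open>x\<close>.\<close>
  have vanish: "cinner x (\<sigma> k x) = 0 \<longleftrightarrow> (\<forall>A\<in>word_products L k. \<rho> (lift_op A x) = 0)" for k x
  proof (induction k arbitrary: x)
    case 0
    then show ?case
      by (simp add: \<sigma>_0 lift_op_mat_1 positive_operator_eq_zero_iff[OF \<rho>(1)])
  next
    case (Suc k)
    have "cinner x (\<sigma> (Suc k) x) = (\<Sum>m\<in>UNIV. cinner (lift_op (L m) x) (\<sigma> k (lift_op (L m) x)))"
      by (simp add: \<sigma>_Suc[OF lin(1)[OF pos]] cinner_sum_right cinner_lift_op_right L_def)
    also have "\<dots> = 0 \<longleftrightarrow> (\<forall>m. cinner (lift_op (L m) x) (\<sigma> k (lift_op (L m) x)) = 0)"
      using lin(3)[OF pos] by (subst sum_nonneg_Reals_eq_0_iff) auto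
    also have "\<dots> \<longleftrightarrow> (\<forall>A\<in>word_products L (Suc k). \<rho> (lift_op A x) = 0)"
      unfolding Suc.IH word_products.simps lift_op_mult[symmetric] by blast
    finally show ?case .
  qed
  \<comment> \<open>The matrices killing \<open>x\<close> in this sense form a subspace; containing
    the short words, it contains all words.\<close>
  have enough: "cinner x (\<sigma> k x) = 0" if "\<And>j. j < t \<Longrightarrow> cinner x (\<sigma> j x) = 0" for x k
  proof -
    have "short_words_span L t \<subseteq> {A. \<rho> (lift_op A x) = 0}"
      unfolding short_words_span_def
      using that by (intro chilbert.span_minimal subspace_lift_op_kernel lin(1) \<rho>) (auto simp: vanish)
    then show ?thesis
      using word_products_subset_short_words_span[OF assms(1), of L k] assms(7)
      unfolding vanish by blast
  qed
  \<comment> \<open>Otherwise the factor \<open>inverse (real t)\<close> would be zero and the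
    average would carry no information.\<close>
  have "t > 0"
  proof -
    have "2\<^sup>2 \<le> CARD('d)\<^sup>2" using assms(1) by (rule power_mono) simp
    then show ?thesis by (simp add: assms(7))
  qed
  define M where "M x = (\<Sum>k<t. \<sigma> k x) /\<^sub>R real t" for x
  have posM: "positive_operator M"
    unfolding M_def[abs_def] by (intro positive_operator_scaleR positive_operator_sum pos) simp
  have compM: "compact_operator M"
    unfolding M_def[abs_def]
    by (rule compact_operator_compose_left[OF compact_operator_sum bounded_linear_scaleR_right])
      (rule comp)
  \<comment> \<open>Nonnegative terms cannot cancel, so the average detects each of them.\<close>
  have M0: "cinner x (M x) = 0 \<longleftrightarrow> (\<forall>k<t. cinner x (\<sigma> k x) = 0)" for x
  proof -
    have "cinner x (M x) = complex_of_real (inverse (real t)) * (\<Sum>k<t. cinner x (\<sigma> k x))"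
      by (simp only: M_def cinner_scaleR_right cinner_sum_right)
    also have "\<dots> = 0 \<longleftrightarrow> (\<Sum>k<t. cinner x (\<sigma> k x)) = 0"
      using \<open>t > 0\<close> by simp
    also have "\<dots> \<longleftrightarrow> (\<forall>k<t. cinner x (\<sigma> k x) = 0)"
      using lin(3)[OF pos] by (subst sum_nonneg_Reals_eq_0_iff) auto
    finally show ?thesis .
  qed
  have "(\<forall>k. \<sigma> k \<Turnstile> P) \<longleftrightarrow> (\<forall>x. P x = 0 \<longrightarrow> (\<forall>k. cinner x (\<sigma> k x) = 0))"
    using satisfies_iff_vanishes_on_kernel[OF pos comp assms(6)] by blast
  also have "\<dots> \<longleftrightarrow> (\<forall>x. P x = 0 \<longrightarrow> cinner x (M x) = 0)"
    unfolding M0 using enough by blast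
  also have "\<dots> \<longleftrightarrow> M \<Turnstile> P"
    using satisfies_iff_vanishes_on_kernel[OF posM compM assms(6)] by blast
  finally show ?thesis
    unfolding \<sigma>_def M_def[abs_def] .
qed

end
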